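(* Let $d\ge1$, let $\mathbf{r}=(r_0,\ldots,r_{d-1})\in\mathrm{int}(\mathcal{D}_d)$ with $r_0\ne0$, let $m$ be the covering degree of $\{\mathcal{T}_\mathbf{r}(\mathbf{x})\mid\mathbf{x}\in\mathbb{Z}^d\}$, and assume that $\mathbf{r}$ satisfies one of the following conditions: - $\mathbf{r}\in\mathbb{Q}^d$; - $(x-\beta)(x^d+r_{d-1}x^{d-1}+\cdots+r_1x+r_0)\in\mathbb{Z}[x]$ for some real $\beta>1$; - $r_0,\ldots,r_{d-1}$ are algebraically independent over $\mathbb{Q}$. Then the set of $m$-exclusive points is dense in $\mathbb{R}^d$, and $\{\mathcal{T}_\mathbf{r}(\mathbf{x})\mid\mathbf{x}\in\mathbb{Z}^d\}$ is a weak $m$-tiling.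
   Context: For $\mathbf{r}=(r_0,\ldots,r_{d-1})\in\mathbb{R}^d$ and $\mathbf{z}=(z_0,\ldots,z_{d-1})^t\in\mathbb{Z}^d$ put $\mathbf{r}\mathbf{z}=\sum_i r_iz_i$ and $\tau_\mathbf{r}(\mathbf{z})=(z_1,\ldots,z_{d-1},-\lfloor\mathbf{r}\mathbf{z}\rfloor)^t$, a map $\mathbb{Z}^d\to\mathbb{Z}^d$; $\tau_\mathbf{r}^{-n}(\mathbf{x})=\{\mathbf{z}\in\mathbb{Z}^d\mid\tau_\mathbf{r}^n(\mathbf{z})=\mathbf{x}\}$. $\mathcal{D}_d$ is the set of $\mathbf{r}\in\mathbb{R}^d$ such that $(\tau_\mathbf{r}^n(\mathbf{z}))_{n}$ is eventually periodic for all $\mathbf{z}\in\mathbb{Z}^d$. The companion matrix $M_\mathbf{r}\in\mathbb{R}^{d\times d}$ has last row $(-r_0,\ldots,-r_{d-1})$, entries $1$ on the superdiagonal of the first $d-1$ rows, and $0$ elsewhere (for $d=1$, $M_\mathbf{r}=(-r_0)$). It is a known fact that $\mathbf{r}\in\mathrm{int}(\mathcal{D}_d)$ if and only if $M_\mathbf{r}$ has spectral radius $<1$. For $\mathbf{r}\in\mathrm{int}(\mathcal{D}_d)$ with $r_0\ne0$, the SRS tile of $\mathbf{x}\in\mathbb{Z}^d$ is $\mathcal{T}_\mathbf{r}(\mathbf{x})=\mathrm{Li}_{n\to\infty}M_\mathbf{r}^n\tau_\mathbf{r}^{-n}(\mathbf{x})$, where the lower Hausdorff limit $\mathrm{Li}_{n\to\infty}A_n$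 is the set of all $\mathbf{t}\in\mathbb{R}^d$ such that each neighbourhood of $\mathbf{t}$ intersects $A_n$ for all sufficiently large $n$. Let $\mathcal{K}=(K_i)_{i\in I}$ be a locally finite family of compact sets covering $\mathbb{R}^d$ (locally finite: every open ball meets only finitely many members); SRS tiles form such a family, indexed by $\mathbf{x}\in\mathbb{Z}^d$. The covering degree of a point is $\deg(\mathcal{K},\mathbf{t})=\#\{i\in I\mid\mathbf{t}\in K_i\}$, and the covering degree of $\mathcal{K}$ is $\deg(\mathcal{K})=\min_{\mathbf{t}\in\mathbb{R}^d}\deg(\mathcal{K},\mathbf{t})$. With $m=\deg(\mathcal{K})$, a point $\mathbf{t}$ is $m$-exclusive if $\deg(\mathcal{K},\mathbf{t})=m$. $\mathcal{K}$ is a weak $m$-tiling if $\deg(\mathcal{K})=m$ and $\bigcap_{k=1}^{m+1}\mathrm{int}(K_{i_k})=\emptyset$ for all pairwise different $i_1,\ldots,i_{m+1}\in I$. *)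

theory Defs
  imports
    "HOL-Analysis.Analysis"
    "HOL-Computational_Algebra.Polynomial"
    "HOL-Library.Poly_Mapping"
begin

text \<open>
  Vectors live in \<open>real ^ 'n\<close> and \<open>int ^ 'n\<close> with \<open>d = CARD('n)\<close>. The type class \<open>linorder\<close> on the
  finite index type provides the numbering of the coordinates: \<open>pos i\<close> is the number in
  \<open>{0..<d}\<close> of the index \<open>i\<close>, and \<open>coord v k\<close> is the mathematical \<open>v\<^sub>k\<close> for \<open>k < d\<close>.
\<close>

definition pos :: "'n::{finite,linorder} \<Rightarrow> nat" where
  "pos i = card {..<i}"

definition coord :: "'a ^ 'n::{finite,linorder} \<Rightarrow> nat \<Rightarrow> 'a" where
  "coord v k = v $ (THE i. pos i = k)"

lemma pos_less: "pos (i :: 'n::{finite,linorder}) < CARD('n)"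
  unfolding pos_def by (rule psubset_card_mono) auto

lemma pos_strict_mono: "i < j \<Longrightarrow> pos i < pos j"
  unfolding pos_def by (rule psubset_card_mono) auto

lemma inj_pos: "inj (pos :: 'n::{finite,linorder} \<Rightarrow> nat)"
proof (rule injI)
  fix i j :: 'n
  assume "pos i = pos j"
  then show "i = j"
    using pos_strict_mono[of i j] pos_strict_mono[of j i] by (cases i j rule: linorder_cases) auto
qed

lemma bij_betw_pos: "bij_betw pos (UNIV :: 'n::{finite,linorder} set) {..<CARD('n)}"
proof -
  have "range (pos :: 'n::{finite,linorder} \<Rightarrow> nat) = {..<CARD('n)}"
    by (rule card_subset_eq) (auto simp: pos_less card_image inj_pos)
  then show ?thesis by (simp add: bij_betw_def inj_pos)
qed

lemma coord_pos [simp]: "coord v (pos i) = v $ i"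
proof -
  have "(THE j. pos j = pos i) = i"
    by (rule the_equality) (simp_all add: inj_eq[OF inj_pos])
  then show ?thesis by (simp add: coord_def)
qed

lemma coord_lambda:
  assumes "k < CARD('n)"
  shows "coord (\<chi> i::'n::{finite,linorder}. f (pos i)) k = f k"
proof -
  have "k \<in> range (pos :: 'n \<Rightarrow> nat)"
    using assms bij_betw_pos[where 'n = 'n] by (simp add: bij_betw_def)
  then obtain i :: 'n where "k = pos i" by blast
  then show ?thesis by simp
qed

definition real_vec :: "int ^ 'n \<Rightarrow> real ^ 'n" where
  "real_vec z = (\<chi> i. real_of_int (z $ i))"


section \<open>Shift radix systems\<close>

definition tau ::
  "real ^ 'n::{finite,linorder} \<Rightarrow> int ^ 'n::{finite,linorder} \<Rightarrow> int ^ 'n::{finite,linorder}" where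
  "tau r z = (\<chi> i. if pos i < CARD('n) - 1 then coord z (pos i + 1) else - \<lfloor>r \<bullet> real_vec z\<rfloor>)"

definition eventually_periodic :: "(nat \<Rightarrow> 'a) \<Rightarrow> bool" where
  "eventually_periodic s \<longleftrightarrow> (\<exists>N p. p > 0 \<and> (\<forall>n\<ge>N. s (n + p) = s n))"

definition srs_D :: "(real ^ 'n::{finite,linorder}) set" where
  "srs_D = {r. \<forall>z. eventually_periodic (\<lambda>n. (tau r ^^ n) z)}"

definition companion ::
  "real ^ 'n::{finite,linorder} \<Rightarrow> real ^ 'n::{finite,linorder} ^ 'n::{finite,linorder}" where
  "companion r = (\<chi> i j. if pos i < CARD('n) - 1 then (if pos j = pos i + 1 then 1 else 0)
                         else - (r $ j))"

definition lower_limit :: "(nat \<Rightarrow> 'a::topological_space set) \<Rightarrow> 'a set" where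
  "lower_limit A = {t. \<forall>U. open U \<and> t \<in> U \<longrightarrow> (\<forall>\<^sub>F n in sequentially. U \<inter> A n \<noteq> {})}"

text \<open>
  The power of the companion matrix is taken as an iterated linear map, since the operations
  \<open>*\<close> and \<open>^\<close> on \<open>real ^ 'n ^ 'n\<close> are componentwise.
\<close>

definition srs_tile ::
  "real ^ 'n::{finite,linorder} \<Rightarrow> int ^ 'n::{finite,linorder} \<Rightarrow> (real ^ 'n::{finite,linorder}) set" where
  "srs_tile r x = lower_limit
     (\<lambda>n. (\<lambda>z. ((\<lambda>v. companion r *v v) ^^ n) (real_vec z)) ` {z. (tau r ^^ n) z = x})"


section \<open>Coverings and weak tilings\<close>

definition locally_finite_compact_cover :: "('i \<Rightarrow> 'a::metric_space set) \<Rightarrow> bool" where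
  "locally_finite_compact_cover K \<longleftrightarrow>
     (\<forall>i. compact (K i)) \<and>
     (\<forall>t e. finite {i. K i \<inter> ball t e \<noteq> {}}) \<and>
     (\<Union>i. K i) = UNIV"

text \<open>For locally finite families, the sets counted here are finite.\<close>

definition degree_at :: "('i \<Rightarrow> 'a set) \<Rightarrow> 'a \<Rightarrow> nat" where
  "degree_at K t = card {i. t \<in> K i}"

definition covering_degree :: "('i \<Rightarrow> 'a set) \<Rightarrow> nat" where
  "covering_degree K = (LEAST k. \<exists>t. degree_at K t = k)"

definition exclusive_points :: "('i \<Rightarrow> 'a set) \<Rightarrow> 'a set" where
  "exclusive_points K = {t. degree_at K t = covering_degree K}"

definition weak_tiling :: "nat \<Rightarrow> ('i \<Rightarrow> 'a::metric_space set) \<Rightarrow> bool" where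
  "weak_tiling m K \<longleftrightarrow>
     locally_finite_compact_cover K \<and>
     covering_degree K = m \<and>
     (\<forall>J. card J = m + 1 \<longrightarrow> (\<Inter>i\<in>J. interior (K i)) = {})"


section \<open>Conditions on the parameter\<close>

definition srs_poly :: "real ^ 'n::{finite,linorder} \<Rightarrow> real poly" where
  "srs_poly r = monom 1 CARD('n) + (\<Sum>k<CARD('n). monom (coord r k) k)"

definition integer_poly :: "real poly \<Rightarrow> bool" where
  "integer_poly p \<longleftrightarrow> (\<forall>k. coeff p k \<in> \<int>)"

text \<open>
  Polynomials over \<open>\<rat>\<close> in the variables \<open>X\<^sub>i\<close>, \<open>i :: 'n\<close>, are finitely supported maps from
  monomials (finitely supported exponent vectors) to coefficients.
\<close>

definition mpoly_eval :: "(('n \<Rightarrow>\<^sub>0 nat) \<Rightarrow>\<^sub>0 rat) \<Rightarrow> real ^ 'n \<Rightarrow> real" where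
  "mpoly_eval p r =
     (\<Sum>e\<in>Poly_Mapping.keys p. of_rat (Poly_Mapping.lookup p e) *
        (\<Prod>i\<in>UNIV. (r $ i) ^ Poly_Mapping.lookup e i))"

definition algebraically_independent :: "real ^ 'n \<Rightarrow> bool" where
  "algebraically_independent r \<longleftrightarrow>
     (\<forall>p :: ('n \<Rightarrow>\<^sub>0 nat) \<Rightarrow>\<^sub>0 rat. mpoly_eval p r = 0 \<longrightarrow> p = 0)"

end

(*
  The covering degree is upper semicontinuous, and the degree at M^n s is at most the degree at s because every
  tile is the union of the M^n-images of the tiles of its n-th preimages; hence the set of exclusive
  points is mapped into itself by the contraction M. It therefore suffices that exclusive points are
  relatively dense. Near an exclusive point t only finitely many n-step orbits matter, and adding an
  integer vector w whose orbit has tiny fractional parts of r tau^k(w) shifts all of them rigidly, so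
  t + M^n w is exclusive as well. Such w are relatively dense: for rational r by taking multiples of a
  power of the denominator, otherwise by pigeonhole once a single w with small positive fractional
  parts is known. The latter comes from the semiconjugacy to the beta-transformation or from Kronecker's
  theorem.
*)
theory Submission
  imports
    Defs
    "HOL-Computational_Algebra.Fundamental_Theorem_Algebra"
    "HOL-Analysis.Kronecker_Approximation_Theorem"
begin

section \<open>Recurrences and roots of the characteristic polynomial\<close>

text \<open>Membership in \<open>interior srs_D\<close> enters through the roots of the
  characteristic polynomial: a root outside the closed disc makes some orbit unbounded, and dilating
  all roots by a factor slightly above 1 rules out the unit circle. Contraction is then phrased as
  summability of \<open>norm ((M ^^ n) v)\<close>. This passes from one linear factor to the next,
  so Jordan blocks never appear, and its tails bound the accumulated rounding errors. Tiles are
  lower limits, so arguments about them need a finite stage. Two estimates with error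
  \<open>tail n\<close> provide it: near each tile point there is an n-step orbit, and near each
  n-step orbit a point of the tile where it ends. The second rests on surjectivity of
  \<open>tau r\<close>, hence on |r_0| <= 1. Pigeonhole alone controls fractional parts only up to
  sign; the vector with positive ones moves these differences into [0, 1), where floors add.\<close>

definition shift_apply :: "'a::comm_ring_1 poly \<Rightarrow> (nat \<Rightarrow> 'a) \<Rightarrow> nat \<Rightarrow> 'a" where
  "shift_apply p v n = (\<Sum>i\<le>degree p. coeff p i * v (n + i))"

lemma shift_apply_eq:
  assumes "degree p \<le> N"
  shows "shift_apply p v n = (\<Sum>i\<le>N. coeff p i * v (n + i))"
  unfolding shift_apply_def
  by (rule sum.mono_neutral_left) (use assms in \<open>auto simp: coeff_eq_0\<close>)

text \<open>\<open>shift_apply p v\<close> is \<open>p(E) v\<close> for the shift operator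
  \<open>E\<close>. Splitting off \<open>E - x\<close> reduces a recurrence to a first-order one
  followed by one of lower order, which drives the induction on the degree.\<close>

lemma shift_apply_linear_factor:
  "shift_apply ([:-x, 1:] * q) v = shift_apply q (\<lambda>n. v (Suc n) - x * v n)"
proof
  fix n
  let ?D = "degree q"
  have deg: "degree ([:-x, 1:] * q) \<le> Suc ?D"
    using degree_mult_le[of "[:-x, 1:]" q] by auto
  have co: "coeff ([:-x, 1:] * q) i = (if i = 0 then 0 else coeff q (i - 1)) - x * coeff q i" for i
    by (cases i) (auto simp: coeff_pCons)
  have "shift_apply ([:-x, 1:] * q) v n
      = (\<Sum>i\<le>Suc ?D. (if i = 0 then 0 else coeff q (i - 1)) * v (n + i)) - (\<Sum>i\<le>Suc ?D. x * coeff q i * v (n + i))"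
    unfolding shift_apply_eq[OF deg] co by (simp add: left_diff_distrib sum_subtractf)
  also have "(\<Sum>i\<le>Suc ?D. x * coeff q i * v (n + i)) = (\<Sum>i\<le>?D. x * coeff q i * v (n + i))"
    by (simp add: coeff_eq_0)
  also have "(\<Sum>i\<le>Suc ?D. (if i = 0 then 0 else coeff q (i - 1)) * v (n + i)) = (\<Sum>i\<le>?D. coeff q i * v (Suc (n + i)))"
    by (subst sum.atMost_Suc_shift) simp
  finally show "shift_apply ([:-x, 1:] * q) v n = shift_apply q (\<lambda>n. v (Suc n) - x * v n) n"
    by (simp add: shift_apply_def right_diff_distrib sum_subtractf mult_ac)
qed

lemma complex_poly_linear_factor:
  fixes p :: "complex poly"
  assumes "degree p = Suc n"
  obtains x q where "poly p x = 0" "p = [:-x, 1:] * q" "degree q = n"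
proof -
  have "\<not> constant (poly p)" using assms by (simp add: constant_degree)
  then obtain x where x: "poly p x = 0" using fundamental_theorem_of_algebra by blast
  then obtain q where q: "p = [:-x, 1:] * q" by (auto simp: poly_eq_0_iff_dvd dvd_def)
  have "q \<noteq> 0" using q assms by auto
  then have "degree ([:-x, 1:] * q) = Suc (degree q)" by (subst degree_mult_eq) auto
  with q assms have "degree q = n" by simp
  with x q show thesis using that by blast
qed

text \<open>By Vieta, the quotient of the two norms is the product of the norms of the roots. For
  the characteristic polynomial this gives |r_0| <= 1.\<close>

lemma norm_coeff_0_le_lead_coeff:
  fixes p :: "complex poly"
  assumes "\<And>x. poly p x = 0 \<Longrightarrow> norm x < 1"
  shows "norm (coeff p 0) \<le> norm (lead_coeff p)"
  using assms
proof (induction "degree p" arbitrary: p)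
  case 0
  then show ?case by simp
next
  case (Suc n)
  obtain x q where xq: "poly p x = 0" "p = [:-x, 1:] * q" "degree q = n"
    using complex_poly_linear_factor[of p n] Suc.hyps(2) by metis
  have x: "norm x < 1" using xq(1) Suc.prems by blast
  have "norm (coeff q 0) \<le> norm (lead_coeff q)"
  proof (rule Suc.hyps(1))
    show "norm y < 1" if "poly q y = 0" for y using that xq Suc.prems by auto
  qed (simp add: xq)
  moreover have "norm (coeff p 0) = norm x * norm (coeff q 0)"
    by (simp add: xq(2) norm_mult)
  moreover have "norm x * norm (coeff q 0) \<le> 1 * norm (coeff q 0)"
    using x by (intro mult_right_mono) auto
  moreover have "lead_coeff p = lead_coeff q"
    unfolding xq(2) lead_coeff_mult by simp
  ultimately show ?case by (metis dual_order.trans mult_1)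
qed

text \<open>Summing \<open>v (Suc n) = x * v n + w n\<close> bounds the partial sum
  \<open>S N\<close> by \<open>norm x * S N + B\<close>, and \<open>norm x < 1\<close> lets the
  first term be absorbed on the left.\<close>

lemma summable_of_summable_first_order:
  fixes v :: "nat \<Rightarrow> 'a::real_normed_field"
  assumes "norm x < 1" "summable (\<lambda>n. norm (v (Suc n) - x * v n))"
  shows "summable (\<lambda>n. norm (v n))"
proof -
  define w where "w n = v (Suc n) - x * v n" for n
  define S where "S N = (\<Sum>n<N. norm (v n))" for N
  define B where "B = norm (v 0) + suminf (\<lambda>n. norm (w n))"
  have W: "(\<Sum>n<N. norm (w n)) \<le> suminf (\<lambda>n. norm (w n))" for N
    by (rule sum_le_suminf) (use assms in \<open>auto simp: w_def\<close>)
  have "S N * (1 - norm x) \<le> B" for N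
  proof -
    have "S N \<le> S (Suc N)" by (simp add: S_def)
    also have "S (Suc N) = norm (v 0) + (\<Sum>n<N. norm (v (Suc n)))"
      unfolding S_def by (rule sum.lessThan_Suc_shift)
    also have "(\<Sum>n<N. norm (v (Suc n))) \<le> (\<Sum>n<N. norm x * norm (v n) + norm (w n))"
    proof (rule sum_mono)
      fix n
      have "v (Suc n) = x * v n + w n" by (simp add: w_def)
      then show "norm (v (Suc n)) \<le> norm x * norm (v n) + norm (w n)"
        by (metis norm_triangle_ineq norm_mult)
    qed
    also have "\<dots> = norm x * S N + (\<Sum>n<N. norm (w n))"
      by (simp add: sum.distrib sum_distrib_left S_def)
    finally show ?thesis using W[of N] by (simp add: B_def algebra_simps)
  qed
  then have "S N \<le> B / (1 - norm x)" for N
    using assms(1) by (simp add: pos_le_divide_eq)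
  then show ?thesis
    unfolding S_def by (intro bounded_imp_summable[where B = "B / (1 - norm x)"])
      (simp_all flip: lessThan_Suc_atMost del: sum.lessThan_Suc)
qed

lemma summable_of_summable_shift_apply:
  fixes p :: "complex poly"
  assumes "p \<noteq> 0" "\<And>x. poly p x = 0 \<Longrightarrow> norm x < 1" "summable (\<lambda>n. norm (shift_apply p v n))"
  shows "summable (\<lambda>n. norm (v n))"
  using assms
proof (induction "degree p" arbitrary: p v)
  case 0
  then obtain c where c: "p = [:c:]" by (metis degree_eq_zeroE)
  with 0 have "c \<noteq> 0" by auto
  have "summable (\<lambda>n. norm c * norm (v n))"
    using 0(4) by (simp add: c shift_apply_def norm_mult)
  then show ?case using \<open>c \<noteq> 0\<close> by (simp add: summable_cmult_iff)
next
  case (Suc n)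
  obtain x q where xq: "poly p x = 0" "p = [:-x, 1:] * q" "degree q = n"
    using complex_poly_linear_factor[of p n] Suc.hyps(2) by metis
  have x: "norm x < 1" using xq(1) Suc.prems by blast
  have "summable (\<lambda>n. norm (v (Suc n) - x * v n))"
  proof (rule Suc.hyps(1))
    show "q \<noteq> 0" using xq Suc.prems by auto
    show "norm y < 1" if "poly q y = 0" for y using that xq Suc.prems by auto
    show "summable (\<lambda>n. norm (shift_apply q (\<lambda>n. v (Suc n) - x * v n) n))"
      using Suc.prems(3) unfolding xq(2) shift_apply_linear_factor .
  qed (simp add: xq)
  then show ?case using x summable_of_summable_first_order by blast
qed


section \<open>Coordinates\<close>

definition idx :: "nat \<Rightarrow> 'n::{finite,linorder}" where
  "idx k = (THE i. pos i = k)"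

lemma pos_idx [simp]: "k < CARD('n) \<Longrightarrow> pos (idx k :: 'n::{finite,linorder}) = k"
proof -
  assume "k < CARD('n)"
  then obtain i :: 'n where i: "k = pos i"
    using bij_betw_pos[where 'n = 'n] unfolding bij_betw_def by blast
  have "(THE j. pos j = pos i) = i"
    by (rule the_equality) (simp_all add: inj_eq[OF inj_pos])
  then show ?thesis by (simp add: idx_def i)
qed

lemma idx_pos [simp]: "idx (pos i) = i"
  by (metis inj_eq inj_pos pos_idx pos_less)

lemma coord_eq_idx: "coord v k = v $ idx k"
  by (simp add: coord_def idx_def)

lemma sum_pos: "(\<Sum>i\<in>(UNIV :: 'n::{finite,linorder} set). f (pos i)) = (\<Sum>k<CARD('n). f k)"
  by (rule sum.reindex_bij_betw[OF bij_betw_pos])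

lemma vec_eq_coordI:
  fixes v w :: "'a ^ 'n::{finite,linorder}"
  assumes "\<And>k. k < CARD('n) \<Longrightarrow> coord v k = coord w k"
  shows "v = w"
  using assms pos_less by (metis coord_pos vec_eq_iff)

lemma inner_coord:
  fixes v w :: "real ^ 'n::{finite,linorder}"
  shows "v \<bullet> w = (\<Sum>k<CARD('n). coord v k * coord w k)"
  by (subst sum_pos[symmetric]) (simp add: inner_vec_def)

lemma coord_real_vec: "coord (real_vec z) k = real_of_int (coord z k)"
  by (simp add: coord_def real_vec_def)

lemma coord_tau:
  fixes z :: "int ^ 'n::{finite,linorder}"
  assumes "k < CARD('n)"
  shows "coord (tau r z) k = (if k < CARD('n) - 1 then coord z (k + 1) else - \<lfloor>r \<bullet> real_vec z\<rfloor>)"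
  unfolding tau_def by (rule coord_lambda[OF assms])

lemma coord_companion:
  fixes v :: "real ^ 'n::{finite,linorder}"
  assumes "k < CARD('n)"
  shows "coord (companion r *v v) k = (if k < CARD('n) - 1 then coord v (k + 1) else - (r \<bullet> v))"
proof -
  have "(companion r *v v) $ i = (if pos i < CARD('n) - 1 then coord v (pos i + 1) else - (r \<bullet> v))" for i :: 'n
  proof (cases "pos i < CARD('n) - 1")
    case True
    have "(companion r *v v) $ i = (\<Sum>j\<in>(UNIV::'n set). (if pos j = pos i + 1 then 1 else 0) * coord v (pos j))"
      using True by (simp add: matrix_vector_mult_def companion_def)
    also have "\<dots> = (\<Sum>k<CARD('n). (if k = pos i + 1 then 1 else 0) * coord v k)"
      by (rule sum_pos)
    also have "\<dots> = (\<Sum>k<CARD('n). if k = pos i + 1 then coord v k else 0)"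
      by (rule sum.cong) auto
    also have "\<dots> = coord v (pos i + 1)" using True by simp
    finally show ?thesis using True by simp
  next
    case False
    then show ?thesis
      by (simp add: matrix_vector_mult_def companion_def inner_vec_def sum_negf)
  qed
  then have "companion r *v v = (\<chi> i. if pos i < CARD('n) - 1 then coord v (pos i + 1) else - (r \<bullet> v))"
    by (simp add: vec_eq_iff)
  then show ?thesis
    using coord_lambda[OF assms, of "\<lambda>k. if k < CARD('n) - 1 then coord v (k + 1) else - (r \<bullet> v)"]
    by simp
qed

lemma coeff_srs_poly:
  fixes r :: "real ^ 'n::{finite,linorder}"
  shows "coeff (srs_poly r) k = (if k < CARD('n) then coord r k else if k = CARD('n) then 1 else 0)"
  by (auto simp: srs_poly_def coeff_sum)

lemma degree_srs_poly:
  fixes r :: "real ^ 'n::{finite,linorder}"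
  shows "degree (srs_poly r) = CARD('n)"
  by (rule antisym[OF degree_le le_degree]) (auto simp: coeff_srs_poly)

abbreviation srs_cpoly :: "real ^ 'n::{finite,linorder} \<Rightarrow> complex poly" where
  "srs_cpoly r \<equiv> map_poly complex_of_real (srs_poly r)"

lemma coeff_srs_cpoly:
  fixes r :: "real ^ 'n::{finite,linorder}"
  shows "coeff (srs_cpoly r) k =
    complex_of_real (if k < CARD('n) then coord r k else if k = CARD('n) then 1 else 0)"
  by (subst coeff_map_poly) (simp_all add: coeff_srs_poly)

lemma degree_srs_cpoly:
  fixes r :: "real ^ 'n::{finite,linorder}"
  shows "degree (srs_cpoly r) = CARD('n)"
  by (subst degree_map_poly) (auto simp: degree_srs_poly)

section \<open>Roots for parameters in the interior\<close>

text \<open>The entries of \<open>z\<close> followed by the one that \<open>tau r\<close> appends: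
  \<open>z\<close> and \<open>tau r z\<close> become two windows of one sequence, at positions 0 to
  d-1 and 1 to d.\<close>

definition tau_seq :: "real ^ 'n::{finite,linorder} \<Rightarrow> int ^ 'n::{finite,linorder} \<Rightarrow> nat \<Rightarrow> int" where
  "tau_seq r z k = (if k < CARD('n) then coord z k else - \<lfloor>r \<bullet> real_vec z\<rfloor>)"

lemma coord_tau_seq:
  fixes z :: "int ^ 'n::{finite,linorder}"
  assumes "k < CARD('n)"
  shows "coord (tau r z) k = tau_seq r z (Suc k)"
  using assms by (auto simp: coord_tau tau_seq_def)

lemma sum_coeff_tau_seq:
  fixes z :: "int ^ 'n::{finite,linorder}"
  shows "(\<Sum>k\<le>CARD('n). coeff (srs_poly r) k * tau_seq r z k) = frac (r \<bullet> real_vec z)"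
proof -
  have "{..CARD('n)} = insert CARD('n) {..<CARD('n)}" by auto
  then have "(\<Sum>k\<le>CARD('n). coeff (srs_poly r) k * tau_seq r z k)
      = (\<Sum>k<CARD('n). coeff (srs_poly r) k * tau_seq r z k) - \<lfloor>r \<bullet> real_vec z\<rfloor>"
    by (simp add: coeff_srs_poly tau_seq_def)
  also have "(\<Sum>k<CARD('n). coeff (srs_poly r) k * tau_seq r z k) = r \<bullet> real_vec z"
    by (simp add: inner_coord coeff_srs_poly tau_seq_def coord_real_vec)
  finally show ?thesis by (simp add: frac_def)
qed

text \<open>The sequence \<open>u\<close> lists the coefficients of \<open>p(X) / (X - x)\<close>: it is a left eigenvector of the companion matrix.\<close>

lemma srs_D_root_norm_le_1:
  fixes r :: "real ^ 'n::{finite,linorder}"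
  assumes "r \<in> srs_D" and root: "poly (srs_cpoly r) x = 0"
  shows "norm x \<le> 1"
proof (rule ccontr)
  assume "\<not> norm x \<le> 1"
  then have x: "norm x > 1" by simp
  let ?d = "CARD('n)"
  let ?p = "srs_cpoly r"
  obtain q where q: "?p = [:-x, 1:] * q" using root by (auto simp: poly_eq_0_iff_dvd dvd_def)
  have "?p \<noteq> 0" using degree_srs_cpoly[of r] by (metis degree_0 less_irrefl zero_less_card_finite)
  then have q0: "q \<noteq> 0" using q by auto
  have degq: "Suc (degree q) = ?d"
    using degree_srs_cpoly[of r] unfolding q by (subst (asm) degree_mult_eq) (use q0 in auto)
  define u where "u = coeff q"
  have u_d: "u k = 0" if "k \<ge> ?d" for k using that degq by (auto simp: u_def intro!: coeff_eq_0)
  have u_last: "u (?d - 1) = 1"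
  proof -
    have "coeff ?p ?d = u (?d - 1) - x * u ?d"
      unfolding q u_def by (cases ?d) (auto simp: coeff_pCons)
    then show ?thesis using u_d[of ?d] by (simp add: coeff_srs_cpoly)
  qed
  have u0: "complex_of_real (coeff (srs_poly r) 0) = - x * u 0"
    using arg_cong[OF q, of "\<lambda>p. coeff p 0"] by (simp add: u_def coeff_map_poly)
  have uS: "complex_of_real (coeff (srs_poly r) (Suc k)) = u k - x * u (Suc k)" for k
    using arg_cong[OF q, of "\<lambda>p. coeff p (Suc k)"] by (simp add: u_def coeff_map_poly)
  define f :: "int ^ 'n::{finite,linorder} \<Rightarrow> complex"
    where "f = (\<lambda>z. \<Sum>k<?d. u k * of_int (coord z k))"
  \<comment> \<open>Inserting the coefficients of \<open>(X - x) q\<close> into the recurrence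
    defect splits it into \<open>f (tau r z)\<close> and \<open>x * f z\<close>.\<close>
  have f_tau: "f (tau r z) = x * f z + of_real (frac (r \<bullet> real_vec z))" for z
  proof -
    let ?Z = "\<lambda>k. of_int (tau_seq r z k) :: complex"
    have split: "(\<Sum>k\<le>?d. g k) = g 0 + (\<Sum>k<?d. g (Suc k))" for g :: "nat \<Rightarrow> complex"
      by (metis lessThan_Suc_atMost sum.lessThan_Suc_shift)
    have "of_real (frac (r \<bullet> real_vec z)) = (\<Sum>k\<le>?d. of_real (coeff (srs_poly r) k) * ?Z k)"
      unfolding sum_coeff_tau_seq[symmetric] by simp
    also have "\<dots> = - x * u 0 * ?Z 0 + (\<Sum>k<?d. (u k - x * u (Suc k)) * ?Z (Suc k))"
      unfolding split u0 uS by simp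
    also have "\<dots> = (\<Sum>k<?d. u k * ?Z (Suc k)) - (\<Sum>k\<le>?d. x * u k * ?Z k)"
      unfolding split by (simp add: left_diff_distrib sum_subtractf)
    also have "(\<Sum>k\<le>?d. x * u k * ?Z k) = x * f z"
      unfolding lessThan_Suc_atMost[symmetric] f_def sum_distrib_left
      by (simp add: u_d tau_seq_def mult_ac)
    also have "(\<Sum>k<?d. u k * ?Z (Suc k)) = f (tau r z)"
      unfolding f_def by (rule sum.cong) (auto simp: coord_tau_seq)
    finally show ?thesis by simp
  qed
  \<comment> \<open>Each step multiplies \<open>f\<close> by x up to an error of norm at most 1.
    From norm N on, the gain \<open>N * (norm x - 1)\<close> beats this error by \<open>c\<close> at
    every step.\<close>
  obtain N :: nat where N: "real N * (norm x - 1) > 1"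
    using x reals_Archimedean3[of "norm x - 1"] by auto
  define z :: "int ^ 'n::{finite,linorder}" where "z = (\<chi> i. if pos i = ?d - 1 then int N else 0)"
  have coord_z: "coord z k = (if k = ?d - 1 then int N else 0)" if "k < ?d" for k
    unfolding z_def by (rule coord_lambda[OF that])
  have "f z = (\<Sum>k<?d. if k = ?d - 1 then of_nat N else 0)"
    unfolding f_def by (rule sum.cong) (use u_last in \<open>auto simp: coord_z\<close>)
  also have "\<dots> = of_nat N" by simp
  finally have fz: "norm (f z) = real N" by simp
  define c where "c = real N * (norm x - 1) - 1"
  have c: "c > 0" using N by (simp add: c_def)
  have grow: "norm (f ((tau r ^^ n) z)) \<ge> real N + n * c" for n
  proof (induction n)
    case 0 then show ?case by (simp add: fz)
  next
    case (Suc n)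
    let ?y = "(tau r ^^ n) z"
    have Nle: "real N \<le> norm (f ?y)"
      using Suc c by (smt (verit, ccfv_SIG) mult_nonneg_nonneg of_nat_0_le_iff)
    have "norm (f (tau r ?y)) \<ge> norm x * norm (f ?y) - norm (complex_of_real (frac (r \<bullet> real_vec ?y)))"
      unfolding f_tau by (metis norm_diff_ineq norm_mult)
    moreover have "norm (complex_of_real (frac (r \<bullet> real_vec ?y))) \<le> 1"
      using frac_lt_1[of "r \<bullet> real_vec ?y"] by simp
    moreover have "(norm x - 1) * norm (f ?y) \<ge> (norm x - 1) * real N"
      using Nle x by (intro mult_left_mono) auto
    ultimately have "norm (f (tau r ?y)) \<ge> norm (f ?y) + c"
      by (simp add: c_def algebra_simps)
    then show ?case using Suc by (simp add: algebra_simps)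
  qed
  from assms(1) have "eventually_periodic (\<lambda>n. (tau r ^^ n) z)" by (simp add: srs_D_def)
  then obtain K p where Kp: "p > 0" "\<And>n. n \<ge> K \<Longrightarrow> (tau r ^^ (n + p)) z = (tau r ^^ n) z"
    by (auto simp: eventually_periodic_def)
  have per: "(tau r ^^ (K + j * p)) z = (tau r ^^ K) z" for j
  proof (induction j)
    case (Suc j)
    have "K + Suc j * p = (K + j * p) + p" by simp
    then show ?case using Kp(2)[of "K + j * p"] Suc by (metis le_add1)
  qed simp
  obtain j :: nat where j: "real j * c > norm (f ((tau r ^^ K) z))"
    using c reals_Archimedean3 by blast
  have "real j \<le> real (K + j * p)" using Kp(1) by (cases p) (auto simp: algebra_simps)
  then have "real j * c \<le> real (K + j * p) * c" using c by (intro mult_right_mono) auto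
  also have "\<dots> \<le> norm (f ((tau r ^^ (K + j * p)) z))" using grow[of "K + j * p"] by linarith
  finally show False using j per[of j] by simp
qed

text \<open>Openness allows the parameter to move so that all roots are multiplied by some s > 1;
  the weak bound at the new parameter is the strict bound at the old one.\<close>

lemma interior_srs_D_root_norm_less_1:
  fixes r :: "real ^ 'n::{finite,linorder}"
  assumes "r \<in> interior srs_D" and root: "poly (srs_cpoly r) x = 0"
  shows "norm x < 1"
proof (rule ccontr)
  assume "\<not> norm x < 1"
  then have x: "norm x \<ge> 1" by simp
  let ?d = "CARD('n)"
  \<comment> \<open>The weight \<open>s ^ (d - k)\<close> on coordinate k makes the polynomial
    homogeneous: its value at \<open>s * x\<close> is \<open>s ^ d\<close> times the old value at
    x.\<close>
  define R where "R s = (\<chi> i::'n. s ^ (?d - pos i) * r $ i)" for s :: real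
  have coord_R: "coord (R s) k = s ^ (?d - k) * coord r k" if "k < ?d" for s k
    using coord_lambda[OF that, of "\<lambda>k. s ^ (?d - k) * coord r k"] by (simp add: R_def)
  have "R 1 = r" by (simp add: R_def vec_eq_iff)
  moreover have "(R \<longlongrightarrow> R 1) (at_right 1)"
    unfolding R_def by (intro vec_tendstoI) (auto intro!: tendsto_eq_intros)
  ultimately have "eventually (\<lambda>s. R s \<in> interior srs_D) (at_right 1)"
    using assms(1) by (auto intro: topological_tendstoD)
  then have "eventually (\<lambda>s. R s \<in> interior srs_D \<and> s > 1) (at_right 1)"
    by (auto intro: eventually_conj eventually_at_right_less)
  then obtain s where s: "R s \<in> interior srs_D" "s > 1"
    by (metis (no_types, lifting) eventually_happens trivial_limit_at_right_real)
  have "poly (srs_cpoly (R s)) (of_real s * x) = of_real s ^ ?d * poly (srs_cpoly r) x"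
    unfolding poly_altdef degree_srs_cpoly sum_distrib_left
  proof (rule sum.cong)
    fix k assume "k \<in> {..?d}"
    then consider "k < ?d" | "k = ?d" by force
    then show "coeff (srs_cpoly (R s)) k * (of_real s * x) ^ k =
        of_real s ^ ?d * (coeff (srs_cpoly r) k * x ^ k)"
    proof cases
      case 1
      have "complex_of_real s ^ (?d - k) * of_real s ^ k = of_real s ^ ?d"
        using 1 by (simp flip: power_add)
      then show ?thesis using 1 by (simp add: coeff_srs_cpoly coord_R power_mult_distrib mult_ac)
    qed (simp add: coeff_srs_cpoly power_mult_distrib)
  qed simp
  then have "poly (srs_cpoly (R s)) (of_real s * x) = 0" by (simp add: root)
  then have "norm (of_real s * x) \<le> 1"
    using srs_D_root_norm_le_1 s(1) interior_subset by blast
  moreover have "1 * 1 < s * norm x" using s(2) x by (intro mult_less_le_imp_less) auto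
  ultimately show False using s(2) by (simp add: norm_mult)
qed


section \<open>Contracting shift radix systems\<close>

lemma real_vec_add: "real_vec (v + w) = real_vec v + real_vec w"
  by (simp add: real_vec_def vec_eq_iff)

lemma real_vec_diff: "real_vec (v - w) = real_vec v - real_vec w"
  by (simp add: real_vec_def vec_eq_iff)

lemma finite_int_vec_ball: "finite {x :: int ^ 'n. norm (real_vec x - t) \<le> B}"
proof -
  define K where "K = \<lceil>B + norm t\<rceil>"
  have "x $ i \<in> {-K..K}" if "norm (real_vec x - t) \<le> B" for x :: "int ^ 'n" and i
  proof -
    have "\<bar>real_of_int (x $ i)\<bar> \<le> norm (real_vec x)"
      using component_le_norm_cart[of "real_vec x" i] by (simp add: real_vec_def)
    also have "\<dots> \<le> B + norm t" using that norm_triangle_sub[of "real_vec x" t] by simp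
    also have "\<dots> \<le> K" by (simp add: K_def)
    finally show ?thesis by auto
  qed
  then have "vec_nth ` {x :: int ^ 'n. norm (real_vec x - t) \<le> B} \<subseteq> (UNIV :: 'n set) \<rightarrow>\<^sub>E {-K..K}"
    by (auto simp del: atLeastAtMost_iff)
  then show ?thesis
    by (rule finite_imageD[OF finite_subset]) (auto intro!: finite_PiE simp: inj_on_def vec_nth_inject)
qed

lemma int_vec_approx:
  fixes v :: "real ^ 'n"
  obtains z :: "int ^ 'n" where "norm (real_vec z - v) \<le> CARD('n)"
proof
  define z :: "int ^ 'n" where "z = (\<chi> i. \<lfloor>v $ i\<rfloor>)"
  have "norm (real_vec z - v) \<le> (\<Sum>i\<in>UNIV. \<bar>(real_vec z - v) $ i\<bar>)" by (rule norm_le_l1_cart)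
  also have "\<dots> \<le> (\<Sum>i\<in>(UNIV :: 'n set). 1)"
    by (rule sum_mono) (simp add: z_def real_vec_def; linarith)
  finally show "norm (real_vec z - v) \<le> CARD('n)" by simp
qed

definition e_last :: "real ^ 'n::{finite,linorder}" where
  "e_last = (\<chi> i. if pos i = CARD('n) - 1 then 1 else 0)"

lemma coord_e_last:
  "k < CARD('n) \<Longrightarrow> coord (e_last :: real ^ 'n::{finite,linorder}) k = (if k = CARD('n) - 1 then 1 else 0)"
  unfolding e_last_def by (rule coord_lambda)

text \<open>The roots of \<open>srs_cpoly r\<close> are the eigenvalues of the companion matrix, so
  the first assumption says spectral radius < 1; the second makes the matrix invertible.\<close>

locale contracting_srs =
  fixes r :: "real ^ 'n::{finite,linorder}"
  assumes root_norm_less_1: "\<And>x. poly (srs_cpoly r) x = 0 \<Longrightarrow> norm x < 1"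
    and coord_0_nonzero: "coord r 0 \<noteq> 0"
begin

abbreviation M :: "real ^ 'n::{finite,linorder} \<Rightarrow> real ^ 'n::{finite,linorder}" where
  "M \<equiv> (\<lambda>v. companion r *v v)"

abbreviation phi :: "int ^ 'n::{finite,linorder} \<Rightarrow> real" where
  "phi z \<equiv> frac (r \<bullet> real_vec z)"

lemma linear_M_funpow: "linear (M ^^ n)"
proof (induction n)
  case (Suc n)
  then show ?case using linear_compose[OF Suc matrix_vector_mul_linear[of "companion r"]]
    by (simp add: o_def)
qed (simp add: linear_iff)

lemma M_funpow_add: "(M ^^ n) (v + w) = (M ^^ n) v + (M ^^ n) w"
  using linear_add[OF linear_M_funpow] .

lemma M_funpow_diff: "(M ^^ n) (v - w) = (M ^^ n) v - (M ^^ n) w"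
  using linear_diff[OF linear_M_funpow] .

lemma M_funpow_scaleR: "(M ^^ n) (c *\<^sub>R v) = c *\<^sub>R (M ^^ n) v"
  using linear_scale[OF linear_M_funpow] .

text \<open>The floor touches only the last coordinate, where
  \<open>- floor y = - y + frac y\<close>.\<close>

lemma real_vec_tau: "real_vec (tau r z) = M (real_vec z) + phi z *\<^sub>R e_last"
proof (rule vec_eq_coordI)
  fix k assume k: "k < CARD('n)"
  have "coord (M (real_vec z) + phi z *\<^sub>R e_last) k = coord (M (real_vec z)) k + phi z * coord (e_last :: real ^ 'n::{finite,linorder}) k"
    by (simp add: coord_def)
  then show "coord (real_vec (tau r z)) k = coord (M (real_vec z) + phi z *\<^sub>R e_last) k"
    using k by (auto simp: coord_real_vec coord_tau coord_companion coord_e_last frac_def)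
qed

lemma M_eq_0D: "v = 0" if "M v = 0"
proof (rule vec_eq_coordI)
  have tl: "coord v k = 0" if "0 < k" "k < CARD('n)" for k
  proof -
    have "coord (M v) (k - 1) = coord v k" using that by (subst coord_companion) auto
    then show ?thesis by (simp add: \<open>M v = 0\<close> coord_eq_idx)
  qed
  have "r \<bullet> v = 0"
    using coord_companion[of "CARD('n) - 1" r v] that by (simp add: coord_def)
  moreover have "r \<bullet> v = coord r 0 * coord v 0"
  proof -
    have "r \<bullet> v = (\<Sum>k<CARD('n). if k = 0 then coord r 0 * coord v 0 else 0)"
      unfolding inner_coord by (rule sum.cong) (auto simp: tl)
    then show ?thesis by simp
  qed
  ultimately have "coord v 0 = 0" using coord_0_nonzero by simp
  then show "coord v k = coord 0 k" if "k < CARD('n)" for k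
    using tl[of k] that by (cases "k = 0") (auto simp: coord_def)
qed

lemma inj_M_funpow: "inj (M ^^ n)"
proof -
  have "inj M"
    using M_eq_0D by (subst linear_inj_iff_eq_0) auto
  then show ?thesis by (rule inj_fn)
qed

lemma surj_M_funpow: "surj (M ^^ n)"
  using linear_injective_imp_surjective[OF linear_M_funpow inj_M_funpow] by simp

text \<open>The superdiagonal rows shift, so the whole orbit under \<open>M\<close> is encoded in
  the scalar sequence of first coordinates.\<close>

lemma coord_M_funpow: "k < CARD('n) \<Longrightarrow> coord ((M ^^ n) v) k = coord ((M ^^ (n + k)) v) 0"
proof (induction k arbitrary: n)
  case (Suc k)
  have "coord ((M ^^ n) v) (Suc k) = coord ((M ^^ Suc n) v) k"
    using Suc.prems by simp (subst coord_companion; simp; linarith)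
  also have "\<dots> = coord ((M ^^ (Suc n + k)) v) 0" using Suc.prems by (intro Suc.IH) simp
  finally show ?case by simp
qed simp

lemma summable_norm_M_funpow: "summable (\<lambda>n. norm ((M ^^ n) v))"
proof -
  let ?d = "CARD('n)"
  define s where "s n = coord ((M ^^ n) v) 0" for n
  have s_add: "s (n + k) = coord ((M ^^ n) v) k" if "k < ?d" for n k
    unfolding s_def by (rule coord_M_funpow[OF that, symmetric])
  \<comment> \<open>The last row of the companion matrix is exactly the recurrence with
    characteristic polynomial \<open>srs_poly r\<close>.\<close>
  have "shift_apply (srs_cpoly r) (\<lambda>n. complex_of_real (s n)) n = 0" for n
  proof -
    have "{..?d} = insert ?d {..<?d}" by auto
    then have "(\<Sum>i\<le>?d. coeff (srs_poly r) i * s (n + i)) = (\<Sum>i<?d. coord r i * s (n + i)) + s (n + ?d)"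
      by (simp add: coeff_srs_poly)
    also have "(\<Sum>i<?d. coord r i * s (n + i)) = r \<bullet> (M ^^ n) v"
      unfolding inner_coord by (rule sum.cong) (auto simp: s_add)
    also have "s (n + ?d) = coord ((M ^^ Suc n) v) (?d - 1)"
      by (subst s_add[symmetric]) simp_all
    also have "\<dots> = - (r \<bullet> (M ^^ n) v)" by (simp add: coord_companion)
    finally have "(\<Sum>i\<le>?d. coeff (srs_poly r) i * s (n + i)) = 0" by simp
    then have "complex_of_real (\<Sum>i\<le>?d. coeff (srs_poly r) i * s (n + i)) = 0" by simp
    then show ?thesis
      unfolding shift_apply_def degree_srs_cpoly by (simp add: coeff_map_poly)
  qed
  then have zero: "summable (\<lambda>n. norm (shift_apply (srs_cpoly r) (\<lambda>n. complex_of_real (s n)) n))"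
    by simp
  have "srs_cpoly r \<noteq> 0" using degree_srs_cpoly[of r] by auto
  then have "summable (\<lambda>n. norm (complex_of_real (s n)))"
    using summable_of_summable_shift_apply[OF _ root_norm_less_1 zero] by blast
  then have s: "summable (\<lambda>n. \<bar>s n\<bar>)" by simp
  show ?thesis
  proof (rule summable_comparison_test')
    show "summable (\<lambda>n. \<Sum>k<?d. \<bar>s (n + k)\<bar>)"
      by (intro summable_sum summable_ignore_initial_segment[OF s])
    fix n :: nat
    have "norm ((M ^^ n) v) \<le> (\<Sum>i\<in>(UNIV :: 'n set). \<bar>coord ((M ^^ n) v) (pos i)\<bar>)"
      using norm_le_l1_cart[of "(M ^^ n) v"] by simp
    also have "\<dots> = (\<Sum>k<?d. \<bar>coord ((M ^^ n) v) k\<bar>)" by (rule sum_pos)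
    also have "\<dots> = (\<Sum>k<?d. \<bar>s (n + k)\<bar>)"
      by (rule sum.cong) (auto simp: s_add)
    finally show "norm (norm ((M ^^ n) v)) \<le> (\<Sum>k<?d. \<bar>s (n + k)\<bar>)" by simp
  qed
qed

lemma abs_coord_0_le_1: "\<bar>coord r 0\<bar> \<le> 1"
  using norm_coeff_0_le_lead_coeff[of "srs_cpoly r"] root_norm_less_1
  by (simp add: degree_srs_cpoly coeff_srs_cpoly)

text \<open>All coordinates of a preimage except the first are dictated by y. The first, q, must put
  \<open>r_0 * q\<close> into a half-open interval of length 1, which succeeds because the step
  |r_0| is at most 1.\<close>

lemma surj_tau: "surj (tau r)"
proof -
  have "\<exists>z. tau r z = y" for y
  proof -
    let ?d = "CARD('n)"
    define c where "c = (\<Sum>k\<in>{0<..<?d}. coord r k * real_of_int (coord y (k - 1)))"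
    define b where "b = - real_of_int (coord y (?d - 1)) - c"
    obtain q :: int where q: "b \<le> coord r 0 * q" "coord r 0 * q < b + 1"
    proof (cases "coord r 0 > 0")
      case True
      define q where "q = \<lceil>b / coord r 0\<rceil>"
      have "b / coord r 0 \<le> q" "q < b / coord r 0 + 1" unfolding q_def by linarith+
      then have "b \<le> coord r 0 * q" "coord r 0 * q < b + coord r 0"
        using True by (simp_all add: field_simps)
      then show thesis using that[of q] abs_coord_0_le_1 by linarith
    next
      case False
      then have neg: "coord r 0 < 0" using coord_0_nonzero by simp
      define q where "q = \<lfloor>b / coord r 0\<rfloor>"
      have "q \<le> b / coord r 0" "b / coord r 0 - 1 < q" unfolding q_def by linarith+
      then have "b \<le> coord r 0 * q" "coord r 0 * q < b - coord r 0"
        using neg by (simp_all add: field_simps)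
      then show thesis using that[of q] abs_coord_0_le_1 by linarith
    qed
    define z :: "int ^ 'n::{finite,linorder}"
      where "z = (\<chi> i. if pos i = 0 then q else coord y (pos i - 1))"
    have z: "coord z k = (if k = 0 then q else coord y (k - 1))" if "k < ?d" for k
      using coord_lambda[OF that, of "\<lambda>k. if k = 0 then q else coord y (k - 1)"] by (simp add: z_def)
    have "{..<?d} = insert 0 {0<..<?d}" by auto
    then have "r \<bullet> real_vec z = coord r 0 * coord z 0 + (\<Sum>k\<in>{0<..<?d}. coord r k * real_of_int (coord z k))"
      by (simp add: inner_coord coord_real_vec)
    also have "\<dots> = coord r 0 * q + c"
      by (auto simp: z c_def intro!: sum.cong)
    finally have "r \<bullet> real_vec z = coord r 0 * q + c" .
    then have "\<lfloor>r \<bullet> real_vec z\<rfloor> = - coord y (?d - 1)"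
      using q by (intro floor_unique) (auto simp: b_def)
    then have "tau r z = y"
      by (intro vec_eq_coordI) (auto simp: coord_tau z intro!: arg_cong[of _ _ "coord y"])
    then show ?thesis ..
  qed
  then show ?thesis by (metis surjI)
qed

text \<open>The sum of the column norms dominates the operator norm and tends to 0 as soon as each
  column does.\<close>

definition op_bound :: "nat \<Rightarrow> real" where
  "op_bound n = (\<Sum>i\<in>UNIV. norm ((M ^^ n) (axis i 1)))"

lemma op_bound_nonneg: "op_bound n \<ge> 0"
  by (simp add: op_bound_def sum_nonneg)

lemma norm_M_funpow_le: "norm ((M ^^ n) v) \<le> op_bound n * norm v"
proof -
  have "(M ^^ n) v = (M ^^ n) (\<Sum>i\<in>UNIV. v $ i *\<^sub>R axis i 1)"
    using basis_expansion[of v] by (simp add: scalar_mult_eq_scaleR)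
  also have "\<dots> = (\<Sum>i\<in>UNIV. v $ i *\<^sub>R (M ^^ n) (axis i 1))"
    by (simp add: linear_sum[OF linear_M_funpow] M_funpow_scaleR)
  also have "norm \<dots> \<le> (\<Sum>i\<in>UNIV. norm v * norm ((M ^^ n) (axis i 1)))"
    by (rule sum_norm_le) (auto intro!: mult_right_mono component_le_norm_cart)
  finally show ?thesis by (simp add: op_bound_def sum_distrib_left mult.commute)
qed

lemma op_bound_tendsto_0: "op_bound \<longlonglongrightarrow> 0"
  unfolding op_bound_def
  by (intro tendsto_null_sum) (rule summable_LIMSEQ_zero[OF summable_norm_M_funpow])

text \<open>The total effect of all rounding errors damped by at least n applications of
  \<open>M\<close>, each error being a multiple of \<open>e_last\<close> with factor in [0,
  1).\<close>

definition tail :: "nat \<Rightarrow> real" where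
  "tail n = suminf (\<lambda>k. norm ((M ^^ (k + n)) e_last))"

lemma tail_tendsto_0: "tail \<longlonglongrightarrow> 0"
proof -
  let ?f = "\<lambda>k. norm ((M ^^ k) e_last)"
  have "tail = (\<lambda>n. suminf ?f - sum ?f {..<n})"
    unfolding tail_def fun_eq_iff using suminf_minus_initial_segment[OF summable_norm_M_funpow] by blast
  moreover have "(\<lambda>n. suminf ?f - sum ?f {..<n}) \<longlonglongrightarrow> suminf ?f - suminf ?f"
    by (intro tendsto_diff tendsto_const summable_LIMSEQ summable_norm_M_funpow)
  ultimately show ?thesis by simp
qed

text \<open>Telescoping: replacing one step of \<open>tau r\<close> by \<open>M\<close> costs one
  rounding error, and the errors are damped with exponents n, ..., n + k - 1. Hence the bound is
  uniform in k.\<close>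

lemma orbit_dist_le_tail:
  "norm ((M ^^ n) (real_vec ((tau r ^^ k) z)) - (M ^^ (n + k)) (real_vec z)) \<le> tail n"
proof -
  have "norm ((M ^^ n) (real_vec ((tau r ^^ k) z)) - (M ^^ (n + k)) (real_vec z))
      \<le> (\<Sum>j<k. norm ((M ^^ (j + n)) e_last))"
  proof (induction k arbitrary: z)
    case (Suc k)
    have "(M ^^ (n + k)) (real_vec (tau r z)) - (M ^^ (n + Suc k)) (real_vec z)
        = phi z *\<^sub>R (M ^^ (k + n)) e_last"
      by (simp add: real_vec_tau M_funpow_add M_funpow_scaleR funpow_swap1 add.commute)
    then have "norm ((M ^^ (n + k)) (real_vec (tau r z)) - (M ^^ (n + Suc k)) (real_vec z))
        \<le> norm ((M ^^ (k + n)) e_last)"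
      using frac_lt_1[of "r \<bullet> real_vec z"] by (simp add: mult_left_le_one_le)
    moreover have "norm ((M ^^ n) (real_vec ((tau r ^^ k) (tau r z))) - (M ^^ (n + k)) (real_vec (tau r z)))
        \<le> (\<Sum>j<k. norm ((M ^^ (j + n)) e_last))" by (rule Suc.IH)
    ultimately show ?case
      unfolding sum.lessThan_Suc funpow_Suc_right o_def
      by (rule norm_diff_triangle_le[rotated])
  qed simp
  also have "\<dots> \<le> tail n"
    unfolding tail_def
    by (rule sum_le_suminf) (auto intro: summable_ignore_initial_segment[OF summable_norm_M_funpow])
  finally show ?thesis .
qed

end


section \<open>Tiles\<close>

lemma norm_diff_via: "norm (s - t) \<le> norm (a - s) + norm (a - t)"
  for a s t :: "'a::real_normed_vector"
  using norm_triangle_ineq4[of "a - t" "a - s"] by simp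

lemma closed_lower_limit: "closed (lower_limit A)"
proof (rule closure_eq[THEN iffD1, OF antisym[OF _ closure_subset]], rule subsetI)
  fix t assume t: "t \<in> closure (lower_limit A)"
  show "t \<in> lower_limit A"
    unfolding lower_limit_def
  proof (intro CollectI allI impI)
    fix U assume U: "open U \<and> t \<in> U"
    then have "U \<inter> closure (lower_limit A) \<noteq> {}" using t by blast
    then have "U \<inter> lower_limit A \<noteq> {}"
      using U open_Int_closure_eq_empty[of U "lower_limit A"] by simp
    then obtain s where s: "s \<in> lower_limit A" "s \<in> U" by blast
    show "\<forall>\<^sub>F n in sequentially. U \<inter> A n \<noteq> {}"
      using s(1)[unfolded lower_limit_def mem_Collect_eq, rule_format, of U] U s(2) by blast
  qed
qed

context contracting_srs
begin

abbreviation T :: "int ^ 'n::{finite,linorder} \<Rightarrow> (real ^ 'n::{finite,linorder}) set" where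
  "T \<equiv> srs_tile r"

text \<open>A late stage n + K approximates t within \<delta>; running the first K steps of that
  orbit leaves n steps and costs at most \<open>tail n\<close>.\<close>

lemma tile_near_orbit:
  assumes "t \<in> T x" "\<delta> > 0"
  obtains z where "(tau r ^^ n) z = x" "norm ((M ^^ n) (real_vec z) - t) < tail n + \<delta>"
proof -
  have "\<forall>\<^sub>F k in sequentially. ball t \<delta> \<inter> (\<lambda>z. (M ^^ k) (real_vec z)) ` {z. (tau r ^^ k) z = x} \<noteq> {}"
    by (rule assms(1)[unfolded srs_tile_def lower_limit_def mem_Collect_eq, rule_format])
      (use assms(2) in simp)
  then obtain K where "\<And>k. k \<ge> K \<Longrightarrow> ball t \<delta> \<inter> (\<lambda>z. (M ^^ k) (real_vec z)) ` {z. (tau r ^^ k) z = x} \<noteq> {}"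
    unfolding eventually_sequentially by blast
  then have "ball t \<delta> \<inter> (\<lambda>z. (M ^^ (n + K)) (real_vec z)) ` {z. (tau r ^^ (n + K)) z = x} \<noteq> {}"
    by simp
  then obtain z where z: "(tau r ^^ (n + K)) z = x" "(M ^^ (n + K)) (real_vec z) \<in> ball t \<delta>"
    by blast
  from z(2) have z': "norm ((M ^^ (n + K)) (real_vec z) - t) < \<delta>"
    unfolding mem_ball dist_norm by (subst norm_minus_commute)
  show thesis
  proof
    show "(tau r ^^ n) ((tau r ^^ K) z) = x" using z(1) by (simp add: funpow_add)
    show "norm ((M ^^ n) (real_vec ((tau r ^^ K) z)) - t) < tail n + \<delta>"
      using orbit_dist_le_tail[of n K z] z'
        norm_triangle_ineq[of "(M ^^ n) (real_vec ((tau r ^^ K) z)) - (M ^^ (n + K)) (real_vec z)"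
          "(M ^^ (n + K)) (real_vec z) - t"] by simp
  qed
qed

text \<open>Successive preimages of z prolong the orbit backwards without end. The renormalised
  starting points form a Cauchy sequence, and its limit lies in the tile because the chain supplies
  a point at every stage from n on, as a lower limit demands.\<close>

lemma orbit_near_tile:
  obtains t where "t \<in> T ((tau r ^^ n) z)" "norm ((M ^^ n) (real_vec z) - t) \<le> tail n"
proof -
  define c where "c k = (inv (tau r) ^^ k) z" for k
  have tau_c: "(tau r ^^ l) (c (k + l)) = c k" for k l
  proof (induction l)
    case (Suc l)
    have "tau r (c (Suc (k + l))) = c (k + l)"
      unfolding c_def by (simp add: surj_f_inv_f[OF surj_tau])
    then show ?case using Suc by (simp add: funpow_swap1)
  qed simp
  define y where "y k = (M ^^ (n + k)) (real_vec (c k))" for k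
  have y_dist: "norm (y k - y (k + l)) \<le> tail (n + k)" for k l
    using orbit_dist_le_tail[of "n + k" l "c (k + l)"] by (simp add: y_def tau_c add.assoc)
  have tail0: "(\<lambda>k. tail (n + k)) \<longlonglongrightarrow> 0"
    using LIMSEQ_ignore_initial_segment[OF tail_tendsto_0, of n] by (simp add: add.commute)
  have "Cauchy y"
  proof (rule metric_CauchyI)
    fix e :: real assume "e > 0"
    then have "\<forall>\<^sub>F k in sequentially. tail (n + k) < e / 2"
      using order_tendstoD(2)[OF tail0, of "e / 2"] by simp
    then obtain K where K: "tail (n + K) < e / 2"
      unfolding eventually_sequentially by blast
    have "dist (y K) (y k) < e / 2" if "k \<ge> K" for k
      using y_dist[of K "k - K"] that K by (simp add: dist_norm)
    then show "\<exists>K. \<forall>k\<ge>K. \<forall>l\<ge>K. dist (y k) (y l) < e"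
      by (metis dist_triangle_half_r)
  qed
  then obtain t where t: "y \<longlonglongrightarrow> t" using Cauchy_convergent convergent_def by blast
  have "norm (y 0 - t) \<le> tail n"
  proof (rule LIMSEQ_le_const2)
    show "(\<lambda>k. norm (y 0 - y k)) \<longlonglongrightarrow> norm (y 0 - t)" by (intro tendsto_intros t)
    show "\<exists>N. \<forall>k\<ge>N. norm (y 0 - y k) \<le> tail n" using y_dist[of 0] by simp
  qed
  moreover have "t \<in> T ((tau r ^^ n) z)"
    unfolding srs_tile_def lower_limit_def
  proof (intro CollectI allI impI)
    fix U assume U: "open U \<and> t \<in> U"
    then have "\<forall>\<^sub>F k in sequentially. y k \<in> U" using t by (auto simp: tendsto_def)
    then obtain K where K: "\<And>k. k \<ge> K \<Longrightarrow> y k \<in> U" unfolding eventually_sequentially by blast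
    have "U \<inter> (\<lambda>z. (M ^^ m) (real_vec z)) ` {w. (tau r ^^ m) w = (tau r ^^ n) z} \<noteq> {}" if "m \<ge> n + K" for m
    proof -
      define k where "k = m - n"
      have k: "m = n + k" "k \<ge> K" using that by (auto simp: k_def)
      have "(tau r ^^ m) (c k) = (tau r ^^ n) z"
        using tau_c[of k 0] by (simp add: k funpow_add c_def)
      moreover have "(M ^^ m) (real_vec (c k)) \<in> U" using K[OF k(2)] by (simp add: y_def k)
      ultimately show ?thesis by blast
    qed
    then show "\<forall>\<^sub>F m in sequentially. U \<inter> (\<lambda>z. (M ^^ m) (real_vec z)) ` {w. (tau r ^^ m) w = (tau r ^^ n) z} \<noteq> {}"
      unfolding eventually_sequentially by blast
  qed
  ultimately show thesis using that by (simp add: y_def c_def)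
qed

lemma tile_subset_cball: "t \<in> T x \<Longrightarrow> norm (real_vec x - t) \<le> tail 0"
  by (rule field_le_epsilon) (metis funpow_0 less_imp_le tile_near_orbit)

lemma compact_tile: "compact (T x)"
proof (rule compact_eq_bounded_closed[THEN iffD2], rule conjI)
  show "bounded (T x)"
  proof (rule boundedI)
    fix t assume "t \<in> T x"
    then show "norm t \<le> norm (real_vec x) + tail 0"
      using tile_subset_cball norm_triangle_sub[of t "real_vec x"] by (fastforce simp: norm_minus_commute)
  qed
  show "closed (T x)" unfolding srs_tile_def by (rule closed_lower_limit)
qed

lemma locally_finite_tiles: "finite {x. T x \<inter> ball t e \<noteq> {}}"
proof (rule finite_subset[OF _ finite_int_vec_ball[of t "tail 0 + e"]], rule subsetI, rule CollectI)
  fix x assume "x \<in> {x. T x \<inter> ball t e \<noteq> {}}"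
  then obtain s where "s \<in> T x" "norm (s - t) < e" by (auto simp: dist_norm norm_minus_commute)
  then show "norm (real_vec x - t) \<le> tail 0 + e"
    using tile_subset_cball[of s x] norm_triangle_ineq[of "real_vec x - s" "s - t"] by simp
qed

lemma finite_tiles_at: "finite {x. t \<in> T x}"
  by (rule finite_subset[OF _ locally_finite_tiles[of t 1]]) auto

text \<open>By local finiteness only finitely many tiles come near t without containing it, and
  their union is closed.\<close>

lemma ball_avoiding_tiles:
  obtains e where "e > 0" "\<And>x s. s \<in> T x \<Longrightarrow> norm (s - t) < e \<Longrightarrow> t \<in> T x"
proof -
  define F where "F = {x. T x \<inter> ball t 1 \<noteq> {} \<and> t \<notin> T x}"
  have "closed (\<Union>x\<in>F. T x)"
    using locally_finite_tiles[of t 1] by (intro closed_UN) (auto simp: F_def compact_imp_closed[OF compact_tile])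
  moreover have "t \<notin> (\<Union>x\<in>F. T x)" by (auto simp: F_def)
  ultimately obtain e where e: "e > 0" "ball t e \<inter> (\<Union>x\<in>F. T x) = {}"
    by (metis Compl_iff disjoint_eq_subset_Compl open_Compl open_contains_ball)
  show thesis
  proof
    show "min e 1 > 0" using e by simp
    fix x s assume "s \<in> T x" "norm (s - t) < min e 1"
    moreover from this have "s \<in> ball t 1" "s \<in> ball t e"
      by (auto simp: dist_norm norm_minus_commute)
    ultimately show "t \<in> T x" using e(2) unfolding F_def by blast
  qed
qed

text \<open>Any subfamily of the tiles has a closed union, so membership claims reduce to
  approximations.\<close>

lemma mem_tile_of_approx:
  assumes "\<And>\<delta>. \<delta> > 0 \<Longrightarrow> \<exists>y\<in>Y. \<exists>s\<in>T y. norm (s - t) < \<delta>"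
  shows "\<exists>y\<in>Y. t \<in> T y"
proof -
  obtain e where e: "e > 0" "\<And>x s. s \<in> T x \<Longrightarrow> norm (s - t) < e \<Longrightarrow> t \<in> T x"
    using ball_avoiding_tiles[of t] by blast
  then show ?thesis using assms[OF e(1)] by blast
qed

lemma eventually_small:
  assumes "\<delta> > 0"
  obtains n where "tail n < \<delta>" "op_bound n * B < \<delta>"
proof -
  have "(\<lambda>n. op_bound n * B) \<longlonglongrightarrow> 0" using op_bound_tendsto_0 by (rule tendsto_mult_left_zero)
  then have "\<forall>\<^sub>F n in sequentially. tail n < \<delta> \<and> op_bound n * B < \<delta>"
    by (intro eventually_conj order_tendstoD(2)[OF _ assms] tail_tendsto_0)
  then show thesis using that unfolding eventually_sequentially by blast
qed

text \<open>The image of the integer lattice under \<open>M ^^ n\<close> becomes arbitrarily fine,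
  and each of its points is within \<open>tail n\<close> of a tile.\<close>

lemma tiles_cover: "\<exists>x. t \<in> T x"
proof -
  have "\<exists>y\<in>UNIV. t \<in> T y"
  proof (rule mem_tile_of_approx)
    fix \<delta> :: real assume "\<delta> > 0"
    then obtain n where n: "tail n < \<delta> / 2" "op_bound n * CARD('n) < \<delta> / 2"
      using eventually_small half_gt_zero by metis
    obtain v where v: "(M ^^ n) v = t" using surj_M_funpow by (metis surjD)
    obtain z where z: "norm (real_vec z - v) \<le> CARD('n)" using int_vec_approx .
    have "norm ((M ^^ n) (real_vec z) - t) \<le> op_bound n * norm (real_vec z - v)"
      unfolding v[symmetric] M_funpow_diff[symmetric] by (rule norm_M_funpow_le)
    also have "\<dots> \<le> op_bound n * CARD('n)" using z op_bound_nonneg by (rule mult_left_mono)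
    finally have 1: "norm ((M ^^ n) (real_vec z) - t) < \<delta> / 2" using n by simp
    obtain s where "s \<in> T ((tau r ^^ n) z)" "norm ((M ^^ n) (real_vec z) - s) \<le> tail n"
      using orbit_near_tile .
    moreover from this have "norm (s - t) < \<delta>"
      using 1 n norm_diff_via[of s t "(M ^^ n) (real_vec z)"] by linarith
    ultimately show "\<exists>y\<in>UNIV. \<exists>s\<in>T y. norm (s - t) < \<delta>" by blast
  qed
  then show ?thesis by blast
qed

lemma locally_finite_compact_cover_tiles: "locally_finite_compact_cover T"
  using compact_tile locally_finite_tiles tiles_cover
  by (auto simp: locally_finite_compact_cover_def)

text \<open>An orbit of n + k steps ending in x is cut after k steps. The lower bound
  \<open>B\<close> for the injective map \<open>M ^^ n\<close> pulls the estimate at stage n + k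
  back to stage k.\<close>

lemma mem_tile_M_funpowD:
  assumes "(M ^^ n) s \<in> T x"
  obtains z where "(tau r ^^ n) z = x" "s \<in> T z"
proof -
  obtain B where B: "B > 0" "\<And>v. B * norm v \<le> norm ((M ^^ n) v)"
    using linear_inj_bounded_below_pos[OF linear_M_funpow inj_M_funpow] by metis
  have "\<exists>y\<in>{z. (tau r ^^ n) z = x}. s \<in> T y"
  proof (rule mem_tile_of_approx)
    fix \<delta> :: real assume "\<delta> > 0"
    \<comment> \<open>Two errors of \<open>B * \<delta> / 4\<close> become
      \<open>\<delta> / 2\<close> after division by \<open>B\<close>; \<open>tail k\<close> accounts
      for the other half.\<close>
    then have "min (\<delta> / 2) (B * \<delta> / 4) > 0" using B by simp
    then obtain k where k0: "tail k < min (\<delta> / 2) (B * \<delta> / 4)"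
      and k: "\<And>j. j \<ge> k \<Longrightarrow> tail j < min (\<delta> / 2) (B * \<delta> / 4)"
      using order_tendstoD(2)[OF tail_tendsto_0] unfolding eventually_sequentially by (metis order_refl)
    obtain z where z: "(tau r ^^ (n + k)) z = x"
      "norm ((M ^^ (n + k)) (real_vec z) - (M ^^ n) s) < tail (n + k) + B * \<delta> / 4"
      using tile_near_orbit[OF assms, of "B * \<delta> / 4" "n + k"] B \<open>\<delta> > 0\<close> by auto
    obtain t where t: "t \<in> T ((tau r ^^ k) z)" "norm ((M ^^ k) (real_vec z) - t) \<le> tail k"
      using orbit_near_tile .
    have "B * norm ((M ^^ k) (real_vec z) - s) \<le> norm ((M ^^ (n + k)) (real_vec z) - (M ^^ n) s)"
      using B(2)[of "(M ^^ k) (real_vec z) - s"] by (simp add: M_funpow_diff funpow_add)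
    also have "\<dots> < B * (\<delta> / 2)" using z(2) k[of "n + k"] by simp
    finally have "norm ((M ^^ k) (real_vec z) - s) < \<delta> / 2" using B(1) by simp
    then have "norm (t - s) < \<delta>"
      using t(2) k0 norm_diff_via[of t s "(M ^^ k) (real_vec z)"] by simp
    moreover have "(tau r ^^ n) ((tau r ^^ k) z) = x" using z(1) by (simp add: funpow_add)
    ultimately show "\<exists>y\<in>{z. (tau r ^^ n) z = x}. \<exists>t\<in>T y. norm (t - s) < \<delta>" using t(1) by blast
  qed
  then show thesis using that by blast
qed


section \<open>Exclusive points\<close>

lemma degree_at_M_funpow_le: "degree_at T ((M ^^ n) s) \<le> degree_at T s"
proof -
  have "{x. (M ^^ n) s \<in> T x} \<subseteq> (tau r ^^ n) ` {z. s \<in> T z}"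
    using mem_tile_M_funpowD by blast
  then have "card {x. (M ^^ n) s \<in> T x} \<le> card ((tau r ^^ n) ` {z. s \<in> T z})"
    by (intro card_mono finite_imageI finite_tiles_at)
  also have "\<dots> \<le> card {z. s \<in> T z}" by (rule card_image_le[OF finite_tiles_at])
  finally show ?thesis by (simp add: degree_at_def)
qed

lemma covering_degree_le: "covering_degree T \<le> degree_at T t"
  unfolding covering_degree_def by (rule Least_le) blast

lemma exclusive_points_iff: "t \<in> exclusive_points T \<longleftrightarrow> degree_at T t \<le> covering_degree T"
  using covering_degree_le[of t] by (auto simp: exclusive_points_def)

lemma exclusive_point_exists: "\<exists>t. t \<in> exclusive_points T"
  unfolding exclusive_points_def covering_degree_def
  using LeastI_ex[of "\<lambda>k. \<exists>t. degree_at T t = k"] by blast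

lemma exclusive_points_M_funpow:
  "s \<in> exclusive_points T \<Longrightarrow> (M ^^ n) s \<in> exclusive_points T"
  using degree_at_M_funpow_le[of n s] by (auto simp: exclusive_points_iff)

text \<open>Adding such a vector causes no carry in the first n floors, provided the other summand
  keeps its fractional parts at distance at least \<eta> from 1.\<close>

definition small_frac :: "nat \<Rightarrow> real \<Rightarrow> (int ^ 'n::{finite,linorder}) set" where
  "small_frac n \<eta> = {w. \<forall>k<n. phi ((tau r ^^ k) w) < \<eta>}"

definition rel_dense :: "(int ^ 'n::{finite,linorder}) set \<Rightarrow> bool" where
  "rel_dense W \<longleftrightarrow> (\<exists>B. \<forall>v. \<exists>w\<in>W. norm (real_vec w - real_vec v) \<le> B)"

lemma tau_add:
  assumes "phi z + phi w < 1"
  shows "tau r (z + w) = tau r z + tau r w"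
proof -
  have "\<lfloor>r \<bullet> real_vec (z + w)\<rfloor> = \<lfloor>r \<bullet> real_vec z\<rfloor> + \<lfloor>r \<bullet> real_vec w\<rfloor>"
    using assms by (simp add: real_vec_add inner_add_right floor_add)
  then show ?thesis by (simp add: tau_def vec_eq_iff coord_def)
qed

lemma tau_funpow_add:
  assumes "\<And>k. k < n \<Longrightarrow> phi ((tau r ^^ k) z) + phi ((tau r ^^ k) w) < 1"
  shows "(tau r ^^ n) (z + w) = (tau r ^^ n) z + (tau r ^^ n) w"
  using assms
proof (induction n)
  case (Suc n)
  then have "(tau r ^^ n) (z + w) = (tau r ^^ n) z + (tau r ^^ n) w" by simp
  then show ?case using tau_add[OF Suc.prems[of n]] by simp
qed simp

lemma exclusive_points_relatively_dense:
  assumes "\<And>n \<eta>. \<eta> > 0 \<Longrightarrow> rel_dense (small_frac n \<eta>)"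
  obtains R where "\<And>s. \<exists>e\<in>exclusive_points T. norm (e - s) \<le> R"
proof -
  obtain t where t: "t \<in> exclusive_points T" using exclusive_point_exists by blast
  obtain \<epsilon> where \<epsilon>: "\<epsilon> > 0" "\<And>x s. s \<in> T x \<Longrightarrow> norm (s - t) < \<epsilon> \<Longrightarrow> t \<in> T x"
    using ball_avoiding_tiles[of t] by blast
  \<comment> \<open>The budget is \<open>tail n + \<epsilon> / 3\<close> from the orbit to t and
    \<open>tail n\<close> from the orbit to its tile, less than \<epsilon> in total.\<close>
  obtain n where n: "tail n < \<epsilon> / 3" using eventually_small[of "\<epsilon> / 3"] \<epsilon>(1) by auto
  define F where "F = {z. norm ((M ^^ n) (real_vec z) - t) < tail n + \<epsilon> / 3}"
  have "finite F"
  proof -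
    obtain B where B: "B > 0" "\<And>v. B * norm v \<le> norm ((M ^^ n) v)"
      using linear_inj_bounded_below_pos[OF linear_M_funpow inj_M_funpow] by metis
    obtain s where s: "(M ^^ n) s = t" using surj_M_funpow by (metis surjD)
    have "norm (real_vec z - s) \<le> (tail n + \<epsilon> / 3) / B" if "z \<in> F" for z
      using that B(1) B(2)[of "real_vec z - s"] by (simp add: F_def M_funpow_diff s pos_le_divide_eq mult.commute)
    then have "F \<subseteq> {z. norm (real_vec z - s) \<le> (tail n + \<epsilon> / 3) / B}" by blast
    then show ?thesis by (rule finite_subset[OF _ finite_int_vec_ball])
  qed
  \<comment> \<open>\<eta> is the least distance to 1 among the fractional parts met from
    \<open>F\<close> in n steps; the element 1 keeps \<open>G\<close> nonempty.\<close>
  define G where "G = insert 1 ((\<lambda>(z, k). 1 - phi ((tau r ^^ k) z)) ` (F \<times> {..<n}))"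
  define \<eta> where "\<eta> = Min G"
  have "finite G" using \<open>finite F\<close> by (simp add: G_def)
  then have \<eta>: "\<eta> > 0"
    unfolding \<eta>_def by (subst Min_gr_iff) (auto simp: G_def frac_lt_1)
  have \<eta>_le: "\<eta> \<le> 1 - phi ((tau r ^^ k) z)" if "z \<in> F" "k < n" for z k
    unfolding \<eta>_def by (rule Min_le[OF \<open>finite G\<close>]) (use that in \<open>auto simp: G_def\<close>)
  have exclusive: "t + (M ^^ n) (real_vec w) \<in> exclusive_points T" if w: "w \<in> small_frac n \<eta>" for w
  proof -
    \<comment> \<open>Subtracting w from an orbit that witnesses a tile at the shifted point gives a
      start in \<open>F\<close>. Its end index differs by \<open>(tau r ^^ n) w\<close>, and its
      tile contains t by the choice of \<epsilon>.\<close>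
    have "{x. t + (M ^^ n) (real_vec w) \<in> T x} \<subseteq> (\<lambda>x. x + (tau r ^^ n) w) ` {x. t \<in> T x}"
    proof (rule subsetI, elim CollectE)
      fix x assume "t + (M ^^ n) (real_vec w) \<in> T x"
      then obtain z' where z': "(tau r ^^ n) z' = x"
        "norm ((M ^^ n) (real_vec z') - (t + (M ^^ n) (real_vec w))) < tail n + \<epsilon> / 3"
        using tile_near_orbit[of _ x "\<epsilon> / 3" n] \<epsilon>(1) by auto
      define z where "z = z' - w"
      have z: "norm ((M ^^ n) (real_vec z) - t) < tail n + \<epsilon> / 3"
        using z'(2) by (simp add: z_def real_vec_diff M_funpow_diff algebra_simps)
      then have "z \<in> F" by (simp add: F_def)
      then have "phi ((tau r ^^ k) z) + phi ((tau r ^^ k) w) < 1" if "k < n" for k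
        using \<eta>_le[of z k] w that by (force simp: small_frac_def)
      then have "x = (tau r ^^ n) z + (tau r ^^ n) w"
        using tau_funpow_add[of n z w] z'(1) by (simp add: z_def)
      moreover obtain s where s: "s \<in> T ((tau r ^^ n) z)" "norm ((M ^^ n) (real_vec z) - s) \<le> tail n"
        using orbit_near_tile .
      have "norm (s - t) < \<epsilon>"
        using s(2) z n norm_diff_via[of s t "(M ^^ n) (real_vec z)"] by linarith
      then have "t \<in> T ((tau r ^^ n) z)" using \<epsilon>(2) s(1) by blast
      ultimately show "x \<in> (\<lambda>x. x + (tau r ^^ n) w) ` {x. t \<in> T x}" by blast
    qed
    then have "degree_at T (t + (M ^^ n) (real_vec w)) \<le> card ((\<lambda>x. x + (tau r ^^ n) w) ` {x. t \<in> T x})"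
      unfolding degree_at_def by (intro card_mono finite_imageI finite_tiles_at)
    also have "\<dots> \<le> degree_at T t" unfolding degree_at_def by (rule card_image_le[OF finite_tiles_at])
    finally show ?thesis using t by (auto simp: exclusive_points_iff)
  qed
  obtain B where B: "\<And>v. \<exists>w\<in>small_frac n \<eta>. norm (real_vec w - real_vec v) \<le> B"
    using assms[OF \<eta>, of n] by (auto simp: rel_dense_def)
  have "\<exists>e\<in>exclusive_points T. norm (e - s) \<le> op_bound n * (B + CARD('n))" for s
  proof -
    obtain u where u: "(M ^^ n) u = s - t" using surj_M_funpow by (metis surjD)
    obtain v where v: "norm (real_vec v - u) \<le> CARD('n)" using int_vec_approx .
    obtain w where w: "w \<in> small_frac n \<eta>" "norm (real_vec w - real_vec v) \<le> B" using B by blast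
    have "norm (real_vec w - u) \<le> B + CARD('n)" using v w(2) by (rule norm_diff_triangle_le[rotated])
    then have "norm ((M ^^ n) (real_vec w - u)) \<le> op_bound n * (B + CARD('n))"
      using norm_M_funpow_le[of n "real_vec w - u"] mult_left_mono[OF _ op_bound_nonneg[of n]] by (meson order_trans)
    moreover have "(M ^^ n) (real_vec w - u) = t + (M ^^ n) (real_vec w) - s"
      by (simp add: M_funpow_diff u)
    ultimately show ?thesis using exclusive[OF w(1)] by metis
  qed
  then show thesis using that by blast
qed

lemma exclusive_points_dense:
  assumes "\<And>n \<eta>. \<eta> > 0 \<Longrightarrow> rel_dense (small_frac n \<eta>)"
  shows "closure (exclusive_points T) = UNIV"
proof -
  obtain R where R: "\<And>s. \<exists>e\<in>exclusive_points T. norm (e - s) \<le> R"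
    using exclusive_points_relatively_dense[OF assms] by blast
  have "\<exists>e\<in>exclusive_points T. dist e t < \<delta>" if "\<delta> > 0" for t \<delta>
  proof -
    obtain n where n: "op_bound n * R < \<delta>" using eventually_small[OF \<open>\<delta> > 0\<close>] by blast
    obtain s where s: "(M ^^ n) s = t" using surj_M_funpow by (metis surjD)
    obtain e where e: "e \<in> exclusive_points T" "norm (e - s) \<le> R" using R by blast
    have "norm ((M ^^ n) e - t) \<le> op_bound n * norm (e - s)"
      unfolding s[symmetric] M_funpow_diff[symmetric] by (rule norm_M_funpow_le)
    also have "\<dots> \<le> op_bound n * R" using e(2) op_bound_nonneg by (rule mult_left_mono)
    also note n
    finally show ?thesis using exclusive_points_M_funpow[OF e(1), of n] by (auto simp: dist_norm)
  qed
  then show ?thesis by (auto simp: closure_approachable)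
qed

text \<open>If m + 1 interiors had a common point, density would place an exclusive point in their
  open intersection, where the degree is at least m + 1.\<close>

lemma weak_tiling_of_dense_exclusive:
  assumes "closure (exclusive_points T) = UNIV"
  shows "weak_tiling (covering_degree T) T"
  unfolding weak_tiling_def
proof (intro conjI allI impI locally_finite_compact_cover_tiles refl)
  fix J :: "(int ^ 'n::{finite,linorder}) set"
  assume J: "card J = covering_degree T + 1"
  then have "finite J" by (auto intro: card_ge_0_finite)
  then have "open (\<Inter>i\<in>J. interior (T i))" by (intro open_INT) auto
  moreover have "(\<Inter>i\<in>J. interior (T i)) \<inter> exclusive_points T = {}"
  proof -
    have False if "t \<in> (\<Inter>i\<in>J. interior (T i))" "t \<in> exclusive_points T" for t
    proof -
      have "J \<subseteq> {x. t \<in> T x}" using that(1) interior_subset by blast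
      then have "card J \<le> degree_at T t"
        unfolding degree_at_def by (intro card_mono finite_tiles_at)
      then show False using that(2) J by (simp add: exclusive_points_iff)
    qed
    then show ?thesis by blast
  qed
  ultimately show "(\<Inter>i\<in>J. interior (T i)) = {}"
    using assms open_Int_closure_eq_empty by (metis Int_UNIV_right)
qed

end


section \<open>Simultaneous approximation\<close>

text \<open>Appending the number 1 turns the absence of integer-valued integer combinations into
  linear independence over the integers.\<close>

lemma kronecker_integer_relations:
  fixes \<theta> \<alpha> :: "nat \<Rightarrow> real"
  assumes rel: "\<And>u :: nat \<Rightarrow> int. (\<Sum>i<n. u i * \<theta> i) \<in> \<int> \<Longrightarrow> \<forall>i<n. u i = 0"
    and "\<epsilon> > 0"
  obtains k :: int and m :: "nat \<Rightarrow> int" where "\<And>i. i < n \<Longrightarrow> \<bar>k * \<theta> i - m i - \<alpha> i\<bar> < \<epsilon>"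
proof -
  define \<theta>' where "\<theta>' i = (if i < n then \<theta> i else 1)" for i
  interpret Modules.module "(\<lambda>r x. of_int r * x) :: int \<Rightarrow> real \<Rightarrow> real"
    by (simp add: Modules.module.intro distrib_left mult.commute)
  have rel': "\<forall>i\<le>n. u i = 0" if "(\<Sum>i\<le>n. u i * \<theta>' i) = 0" for u :: "nat \<Rightarrow> int"
  proof -
    have "(\<Sum>i\<le>n. u i * \<theta>' i) = (\<Sum>i<n. u i * \<theta> i) + u n"
      by (simp add: \<theta>'_def flip: lessThan_Suc_atMost)
    then have *: "(\<Sum>i<n. u i * \<theta> i) = real_of_int (- u n)" using that by simp
    then have "(\<Sum>i<n. u i * \<theta> i) \<in> \<int>" by (metis Ints_of_int)
    then have zero: "\<forall>i<n. u i = 0" by (rule rel)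
    then have "(\<Sum>i<n. u i * \<theta> i) = 0" by simp
    with * have "u n = 0" by simp
    with zero show ?thesis by (auto simp: le_less)
  qed
  \<comment> \<open>\<open>independent\<close> speaks about a set of reals and would not see a
    repeated value; the relation with coefficients 1 and -1 excludes repetitions.\<close>
  have inj: "inj_on \<theta>' {..n}"
  proof (rule inj_onI, rule ccontr)
    fix i j assume ij: "i \<in> {..n}" "j \<in> {..n}" "\<theta>' i = \<theta>' j" "i \<noteq> j"
    define u :: "nat \<Rightarrow> int" where "u = (\<lambda>k. (if k = i then 1 else 0) - (if k = j then 1 else 0))"
    have "(\<Sum>k\<le>n. u k * \<theta>' k) = (\<Sum>k\<le>n. if k = i then \<theta>' i else 0) - (\<Sum>k\<le>n. if k = j then \<theta>' j else 0)"
      unfolding sum_subtractf[symmetric] by (rule sum.cong) (auto simp: u_def)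
    also have "\<dots> = 0" using ij by simp
    finally have "u i = 0" using rel'[of u] ij(1) by simp
    then show False using ij(4) by (simp add: u_def)
  qed
  have "independent (\<theta>' ` {..n})"
  proof
    assume "dependent (\<theta>' ` {..n})"
    then obtain u v where u: "v \<in> \<theta>' ` {..n}" "u v \<noteq> 0" "(\<Sum>v\<in>\<theta>' ` {..n}. of_int (u v) * v) = 0"
      by (auto simp: dependent_finite)
    then have "(\<Sum>i\<le>n. of_int (u (\<theta>' i)) * \<theta>' i) = 0" using inj by (simp add: sum.reindex)
    then show False using rel'[of "\<lambda>i. u (\<theta>' i)"] u(1,2) by auto
  qed
  then obtain k m where "\<And>i. i < n \<Longrightarrow> \<bar>of_int k * \<theta>' i - of_int (m i) - \<alpha> i\<bar> < \<epsilon>"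
    using Kronecker_thm_2[where \<theta> = \<theta>' and n = n and \<epsilon> = \<epsilon> and \<alpha> = \<alpha>] inj \<open>\<epsilon> > 0\<close> by (auto simp: \<theta>'_def)
  then show thesis using that[of k m] by (auto simp: \<theta>'_def)
qed

lemma irrational_small_frac:
  fixes a :: real
  assumes "a \<notin> \<rat>" "\<delta> > 0"
  obtains k :: int where "0 < frac (k * a)" "frac (k * a) < \<delta>"
proof -
  define \<eta> where "\<eta> = min \<delta> 1"
  have \<eta>: "0 < \<eta>" "\<eta> \<le> 1" "\<eta> \<le> \<delta>" using assms(2) by (auto simp: \<eta>_def)
  have "\<forall>i<1. u i = 0" if "(\<Sum>i<1::nat. real_of_int (u i) * a) \<in> \<int>" for u :: "nat \<Rightarrow> int"
  proof (rule ccontr)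
    assume "\<not> (\<forall>i<1. u i = 0)"
    then have "u 0 \<noteq> 0" by simp
    moreover have "real_of_int (u 0) * a \<in> \<rat>" using that Ints_subset_Rats by auto
    ultimately have "real_of_int (u 0) * a / real_of_int (u 0) \<in> \<rat>" by (intro Rats_divide) auto
    then show False using assms(1) \<open>u 0 \<noteq> 0\<close> by simp
  qed
  \<comment> \<open>Centre and tolerance both equal to \<open>\<eta> / 2\<close> give the open
    interval (0, \<eta>), which excludes 0.\<close>
  then obtain k :: int and m :: "nat \<Rightarrow> int" where "\<And>i. i < 1 \<Longrightarrow> \<bar>k * a - m i - \<eta> / 2\<bar> < \<eta> / 2"
    using kronecker_integer_relations[where n = 1 and \<theta> = "\<lambda>_. a" and \<epsilon> = "\<eta> / 2" and \<alpha> = "\<lambda>_. \<eta> / 2"] \<eta>(1)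
    by (metis half_gt_zero)
  then have m: "\<bar>k * a - m 0 - \<eta> / 2\<bar> < \<eta> / 2" by simp
  then have "0 < k * a - m 0" "k * a - m 0 < \<eta>" unfolding abs_diff_less_iff by linarith+
  moreover from this have "frac (k * a) = k * a - m 0" using \<eta> by (simp add: frac_unique_iff)
  ultimately show thesis using that[of k] \<eta> by simp
qed


section \<open>Polynomial functions and algebraic independence\<close>

lemma mpoly_eval_superset:
  assumes "finite S" "Poly_Mapping.keys p \<subseteq> S"
  shows "mpoly_eval p s = (\<Sum>e\<in>S. of_rat (Poly_Mapping.lookup p e) * (\<Prod>i\<in>UNIV. (s $ i) ^ Poly_Mapping.lookup e i))"
  unfolding mpoly_eval_def
  by (rule sum.mono_neutral_left) (use assms in \<open>auto simp: in_keys_iff\<close>)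

lemma mpoly_eval_0 [simp]: "mpoly_eval 0 s = 0"
  by (simp add: mpoly_eval_def)

lemma mpoly_eval_add: "mpoly_eval (p + q) s = mpoly_eval p s + mpoly_eval q s"
proof -
  let ?S = "Poly_Mapping.keys p \<union> Poly_Mapping.keys q"
  have S: "finite ?S" "Poly_Mapping.keys p \<subseteq> ?S" "Poly_Mapping.keys q \<subseteq> ?S" by auto
  show ?thesis
    unfolding mpoly_eval_superset[OF S(1) Poly_Mapping.keys_add] mpoly_eval_superset[OF S(1,2)]
      mpoly_eval_superset[OF S(1,3)]
    by (simp add: lookup_add of_rat_add distrib_right sum.distrib)
qed

lemma mpoly_eval_sum: "mpoly_eval (\<Sum>x\<in>A. f x) s = (\<Sum>x\<in>A. mpoly_eval (f x) s)"
  by (induction A rule: infinite_finite_induct) (auto simp: mpoly_eval_add)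

lemma mpoly_eval_single:
  "mpoly_eval (Poly_Mapping.single e c) s = of_rat c * (\<Prod>i\<in>UNIV. (s $ i) ^ Poly_Mapping.lookup e i)"
  by (subst mpoly_eval_superset[of "{e}"]) auto

text \<open>Closure rules for evaluation functions replace the computation of coefficients for
  powers of the companion matrix.\<close>

definition rat_poly_fun :: "(real ^ 'n \<Rightarrow> real) \<Rightarrow> bool" where
  "rat_poly_fun f \<longleftrightarrow> (\<exists>p :: ('n \<Rightarrow>\<^sub>0 nat) \<Rightarrow>\<^sub>0 rat. f = mpoly_eval p)"

lemma rat_poly_fun_const: "rat_poly_fun (\<lambda>s. of_rat c)"
  unfolding rat_poly_fun_def
  by (rule exI[of _ "Poly_Mapping.single 0 c"]) (simp add: mpoly_eval_single fun_eq_iff)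

lemma rat_poly_fun_add: "rat_poly_fun f \<Longrightarrow> rat_poly_fun g \<Longrightarrow> rat_poly_fun (\<lambda>s. f s + g s)"
  for f g :: "real ^ 'n \<Rightarrow> real"
proof -
  assume "rat_poly_fun f" "rat_poly_fun g"
  then obtain p q :: "('n \<Rightarrow>\<^sub>0 nat) \<Rightarrow>\<^sub>0 rat" where "f = mpoly_eval p" "g = mpoly_eval q"
    unfolding rat_poly_fun_def by blast
  then have "(\<lambda>s. f s + g s) = mpoly_eval (p + q)" by (simp add: fun_eq_iff mpoly_eval_add)
  then show ?thesis unfolding rat_poly_fun_def by blast
qed

lemma rat_poly_fun_sum:
  "(\<And>x. x \<in> A \<Longrightarrow> rat_poly_fun (f x)) \<Longrightarrow> rat_poly_fun (\<lambda>s. \<Sum>x\<in>A. f x s)"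
proof (induction A rule: infinite_finite_induct)
  case (insert x A)
  then show ?case using rat_poly_fun_add[of "f x"] by simp
qed (use rat_poly_fun_const[of 0] in auto)

lemma rat_poly_fun_term_mult:
  fixes f :: "real ^ 'n \<Rightarrow> real"
  assumes "rat_poly_fun f"
  shows "rat_poly_fun (\<lambda>s. of_rat c * (\<Prod>i\<in>UNIV. (s $ i) ^ Poly_Mapping.lookup e i) * f s)"
proof -
  obtain p :: "('n \<Rightarrow>\<^sub>0 nat) \<Rightarrow>\<^sub>0 rat" where p: "f = mpoly_eval p"
    using assms by (auto simp: rat_poly_fun_def)
  let ?q = "\<Sum>e'\<in>Poly_Mapping.keys p. Poly_Mapping.single (e + e') (c * Poly_Mapping.lookup p e')"
  have "of_rat c * (\<Prod>i\<in>UNIV. (s $ i) ^ Poly_Mapping.lookup e i) * f s = mpoly_eval ?q s" for s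
    by (simp add: p mpoly_eval_sum mpoly_eval_single mpoly_eval_def[of p] lookup_add power_add
        prod.distrib sum_distrib_left of_rat_mult mult_ac)
  then show ?thesis unfolding rat_poly_fun_def by blast
qed

lemma rat_poly_fun_scale: "rat_poly_fun f \<Longrightarrow> rat_poly_fun (\<lambda>s. of_rat c * f s)"
  using rat_poly_fun_term_mult[of f c 0] by simp

lemma rat_poly_fun_coord_mult:
  fixes f :: "real ^ 'n \<Rightarrow> real"
  assumes "rat_poly_fun f"
  shows "rat_poly_fun (\<lambda>s. s $ j * f s)"
proof -
  have "(\<Prod>i\<in>UNIV. (s $ i) ^ Poly_Mapping.lookup (Poly_Mapping.single j 1) i) = s $ j" for s :: "real ^ 'n"
  proof -
    have "(\<Prod>i\<in>UNIV. (s $ i) ^ Poly_Mapping.lookup (Poly_Mapping.single j 1) i) = (\<Prod>i\<in>UNIV. if i = j then s $ j else 1)"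
      by (rule prod.cong) (auto simp: lookup_single)
    then show ?thesis by simp
  qed
  then show ?thesis
    using rat_poly_fun_term_mult[OF assms, of 1 "Poly_Mapping.single j 1"] by simp
qed

text \<open>A relation at r becomes an identity in the parameter and can be tested at a convenient
  special one.\<close>

lemma rat_poly_fun_eq_0:
  assumes "algebraically_independent r" "rat_poly_fun f" "f r = 0"
  shows "f s = 0"
proof -
  obtain p where p: "f = mpoly_eval p" using assms(2) by (auto simp: rat_poly_fun_def)
  then have "p = 0" using assms(1,3) by (simp add: algebraically_independent_def)
  then show ?thesis by (simp add: p)
qed

lemma rat_poly_fun_inner:
  assumes "\<And>i. rat_poly_fun (\<lambda>s. g s $ i)"
  shows "rat_poly_fun (\<lambda>s. s \<bullet> g s)"
  unfolding inner_vec_def inner_real_def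
  by (rule rat_poly_fun_sum, rule rat_poly_fun_coord_mult, rule assms)

lemma rat_poly_fun_companion_funpow:
  "rat_poly_fun (\<lambda>s. (((\<lambda>v. companion s *v v) ^^ k) e_last) $ (i :: 'n::{finite,linorder}))"
proof (induction k arbitrary: i)
  case 0
  then show ?case
    using rat_poly_fun_const[of "if pos i = CARD('n) - 1 then 1 else 0"]
    by (simp add: e_last_def if_distrib[of of_rat] cong: if_cong)
next
  case (Suc k)
  let ?v = "\<lambda>s. ((\<lambda>v. companion s *v v) ^^ k) e_last"
  have eq: "(((\<lambda>v. companion s *v v) ^^ Suc k) e_last) $ i
      = (if pos i < CARD('n) - 1 then ?v s $ idx (pos i + 1) else of_rat (-1) * (s \<bullet> ?v s))"
    for s :: "real ^ 'n::{finite,linorder}"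
    using coord_companion[OF pos_less[of i], of s "?v s"] by (simp add: coord_eq_idx)
  show ?case
    unfolding eq using Suc.IH rat_poly_fun_scale[OF rat_poly_fun_inner[OF Suc.IH], of "-1"]
    by (cases "pos i < CARD('n) - 1") (simp_all only: if_True if_False)
qed

text \<open>The relation is a rational polynomial identity in r, hence valid for every s. On the
  line \<open>s = - x e_last\<close> it becomes a polynomial in x with coefficients
  \<open>u k\<close> up to sign, besides the constant term.\<close>

lemma algebraically_independent_integer_relations:
  fixes r :: "real ^ 'n::{finite,linorder}" and u :: "nat \<Rightarrow> int"
  assumes "algebraically_independent r"
    and "(\<Sum>k<n. u k * (r \<bullet> ((\<lambda>v. companion r *v v) ^^ k) e_last)) \<in> \<int>"
  shows "\<forall>k<n. u k = 0"
proof -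
  let ?v = "\<lambda>s k. ((\<lambda>v. companion s *v v) ^^ k) e_last :: real ^ 'n::{finite,linorder}"
  obtain K where K: "(\<Sum>k<n. u k * (r \<bullet> ?v r k)) = real_of_int K" using assms(2) by (auto elim: Ints_cases)
  define f where "f s = (\<Sum>k<n. of_rat (of_int (u k)) * (s \<bullet> ?v s k)) + of_rat (of_int (- K))" for s
  have "rat_poly_fun f"
    unfolding f_def
    by (intro rat_poly_fun_add rat_poly_fun_sum rat_poly_fun_scale rat_poly_fun_inner
        rat_poly_fun_companion_funpow rat_poly_fun_const)
  moreover have "f r = 0" using K by (simp add: f_def of_rat_minus)
  ultimately have f0: "f s = 0" for s by (rule rat_poly_fun_eq_0[OF assms(1)])
  define P where "P = (\<Sum>k<n. monom (- real_of_int (u k)) (Suc k)) + [:- real_of_int K:]"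
  have "poly P x = 0" for x
  proof -
    \<comment> \<open>The last row of the companion matrix is now (0, ..., 0, x), so the last
      coordinate of the k-th iterate of \<open>e_last\<close> is \<open>x ^ k\<close>, and the k-th
      term has degree \<open>Suc k\<close>.\<close>
    let ?s = "(- x) *\<^sub>R e_last :: real ^ 'n::{finite,linorder}"
    have inner: "?s \<bullet> v = - x * coord v (CARD('n) - 1)" for v
    proof -
      have "?s \<bullet> v = (\<Sum>k<CARD('n). if k = CARD('n) - 1 then - x * coord v (CARD('n) - 1) else 0)"
        unfolding inner_coord
      proof (rule sum.cong)
        fix k assume "k \<in> {..<CARD('n)}"
        moreover have "coord ?s k = - x * coord (e_last :: real ^ 'n::{finite,linorder}) k"
          by (simp add: coord_eq_idx)
        ultimately show "coord ?s k * coord v k = (if k = CARD('n) - 1 then - x * coord v (CARD('n) - 1) else 0)"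
          by (simp add: coord_e_last)
      qed simp
      then show ?thesis by simp
    qed
    have "coord (?v ?s k) (CARD('n) - 1) = x ^ k" for k
    proof (induction k)
      case 0
      then show ?case by (simp add: coord_e_last)
    next
      case (Suc k)
      then show ?case using inner[of "?v ?s k"]
        by (simp del: inner_scaleR_left add: coord_companion)
    qed
    then have "f ?s = (\<Sum>k<n. real_of_int (u k) * (- x * x ^ k)) - K"
      unfolding f_def inner by (simp add: of_rat_minus)
    also have "\<dots> = poly P x"
      by (simp add: P_def poly_sum poly_monom sum_negf)
    finally show ?thesis using f0 by simp
  qed
  then have "P = 0" using poly_all_0_iff_0 by blast
  have "u k = 0" if "k < n" for k
  proof -
    have "coeff P (Suc k) = (\<Sum>j<n. if j = k then - real_of_int (u j) else 0)"
      by (simp add: P_def coeff_sum coeff_pCons if_distrib cong: if_cong)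
    also have "\<dots> = - real_of_int (u k)" using that by simp
    finally show ?thesis using \<open>P = 0\<close> by simp
  qed
  then show ?thesis by blast
qed

section \<open>Integer vectors with small fractional parts\<close>

context contracting_srs
begin

section \<open>Rational parameters\<close>

lemma phi_eq_0_of_dvd:
  fixes q :: int and z :: "int ^ 'n::{finite,linorder}"
  assumes q: "\<And>i. real_of_int q * r $ i \<in> \<int>" and z: "\<And>i. q ^ Suc j dvd z $ i"
  shows "phi z = 0" "q ^ j dvd tau r z $ i"
proof -
  define c where "c i = \<lfloor>real_of_int q * r $ i\<rfloor>" for i
  have c: "real_of_int q * r $ i = real_of_int (c i)" for i
    unfolding c_def using q by (simp add: of_int_floor)
  define y where "y i = z $ i div q ^ Suc j" for i
  have y: "z $ i = q ^ Suc j * y i" for i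
    unfolding y_def using z by (rule dvd_mult_div_cancel[symmetric])
  have "r \<bullet> real_vec z = (\<Sum>i\<in>UNIV. real_of_int (q ^ j * c i * y i))"
    unfolding inner_vec_def
  proof (rule sum.cong)
    fix i
    have "r $ i \<bullet> real_vec z $ i = real_of_int q ^ j * (real_of_int q * r $ i) * y i"
      by (simp add: real_vec_def y mult_ac)
    then show "r $ i \<bullet> real_vec z $ i = real_of_int (q ^ j * c i * y i)" unfolding c by simp
  qed simp
  also have "\<dots> = real_of_int (q ^ j * (\<Sum>i\<in>UNIV. c i * y i))"
    by (simp add: sum_distrib_left mult.assoc)
  finally have rz: "r \<bullet> real_vec z = real_of_int (q ^ j * (\<Sum>i\<in>UNIV. c i * y i))" .
  show "phi z = 0" unfolding rz by (rule frac_of_int)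
  have "q ^ j dvd coord z k" for k
    unfolding coord_eq_idx by (rule dvd_trans[OF _ z]) simp
  moreover have "\<lfloor>r \<bullet> real_vec z\<rfloor> = q ^ j * (\<Sum>i\<in>UNIV. c i * y i)" unfolding rz by (rule floor_of_int)
  ultimately show "q ^ j dvd tau r z $ i" by (simp add: tau_def)
qed

lemma rel_dense_rational:
  assumes "\<And>i. r $ i \<in> \<rat>" "\<eta> > 0"
  shows "rel_dense (small_frac n \<eta>)"
proof -
  have "\<exists>b::int. b > 0 \<and> real_of_int b * r $ i \<in> \<int>" for i
  proof -
    obtain a b :: int where ab: "b > 0" "r $ i = of_int a / of_int b"
      by (rule Rats_cases'[OF assms(1)])
    then have "real_of_int b * r $ i = of_int a" by simp
    then show ?thesis using ab(1) by (metis Ints_of_int)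
  qed
  then obtain b :: "'n \<Rightarrow> int" where b: "\<And>i. b i > 0" "\<And>i. real_of_int (b i) * r $ i \<in> \<int>"
    using choice[of "\<lambda>i b. b > 0 \<and> real_of_int b * r $ i \<in> \<int>"] by blast
  define q where "q = (\<Prod>i\<in>UNIV. b i)"
  have q0: "q > 0" unfolding q_def using b(1) by (intro prod_pos) auto
  have q: "real_of_int q * r $ i \<in> \<int>" for i
  proof -
    have "b i dvd q" unfolding q_def by (rule dvd_prodI) auto
    then obtain c where "q = c * b i" by (metis dvd_def mult.commute)
    then have "real_of_int q * r $ i = real_of_int c * (real_of_int (b i) * r $ i)" by simp
    then show ?thesis using b(2) by (metis Ints_mult Ints_of_int)
  qed
  \<comment> \<open>Each step spends one factor q on making the inner product an integer, so
    \<open>q ^ n\<close> lasts for n steps.\<close>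
  have orbit: "\<forall>i. q ^ (n - k) dvd (tau r ^^ k) w $ i" if "k \<le> n" "\<forall>i. q ^ n dvd w $ i" for k w
    using that(1)
  proof (induction k)
    case (Suc k)
    then have "\<forall>i. q ^ Suc (n - Suc k) dvd (tau r ^^ k) w $ i" by (simp add: Suc_diff_Suc del: power_Suc)
    then show ?case using phi_eq_0_of_dvd(2)[OF q] by simp
  qed (use that in simp)
  have small: "w \<in> small_frac n \<eta>" if w: "\<forall>i. q ^ n dvd w $ i" for w
    unfolding small_frac_def
  proof (intro CollectI allI impI)
    fix k assume k: "k < n"
    then have "\<forall>i. q ^ Suc (n - Suc k) dvd (tau r ^^ k) w $ i"
      using orbit[OF _ w, of k] by (simp add: Suc_diff_Suc del: power_Suc)
    then have "phi ((tau r ^^ k) w) = 0" by (intro phi_eq_0_of_dvd(1)[OF q]) blast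
    then show "phi ((tau r ^^ k) w) < \<eta>" using assms(2) by linarith
  qed
  have "\<exists>w\<in>small_frac n \<eta>. norm (real_vec w - real_vec v) \<le> CARD('n) * q ^ n" for v
  proof
    define w :: "int ^ 'n::{finite,linorder}" where "w = (\<chi> i. q ^ n * (v $ i div q ^ n))"
    show "w \<in> small_frac n \<eta>" by (rule small) (simp add: w_def)
    have "norm (real_vec w - real_vec v) \<le> (\<Sum>i\<in>UNIV. \<bar>(real_vec w - real_vec v) $ i\<bar>)"
      by (rule norm_le_l1_cart)
    also have "\<dots> \<le> (\<Sum>i\<in>(UNIV :: 'n set). real_of_int (q ^ n))"
    proof (rule sum_mono)
      fix i
      have "\<bar>w $ i - v $ i\<bar> = v $ i mod q ^ n"
        using q0 by (simp add: w_def minus_mult_div_eq_mod[symmetric] abs_minus_commute)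
          (simp add: minus_mult_div_eq_mod)
      also have "\<dots> \<le> q ^ n" using q0 by (simp add: less_imp_le)
      finally show "\<bar>(real_vec w - real_vec v) $ i\<bar> \<le> real_of_int (q ^ n)"
        unfolding real_vec_def by simp (metis of_int_abs of_int_diff of_int_le_iff of_int_power)
    qed
    finally show "norm (real_vec w - real_vec v) \<le> CARD('n) * q ^ n" by simp
  qed
  then show ?thesis unfolding rel_dense_def by blast
qed

section \<open>Pigeonhole for fractional parts along orbits\<close>

lemma tau_add_diff:
  assumes "0 \<le> phi a + phi b - phi c" "phi a + phi b - phi c < 1"
  shows "tau r (a + b - c) = tau r a + tau r b - tau r c"
    and "phi (a + b - c) = phi a + phi b - phi c"
proof -
  let ?F = "\<lambda>z. \<lfloor>r \<bullet> real_vec z\<rfloor>"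
  have eq: "r \<bullet> real_vec (a + b - c) = real_of_int (?F a + ?F b - ?F c) + (phi a + phi b - phi c)"
    by (simp add: real_vec_add real_vec_diff inner_add_right inner_diff_right frac_def)
  have fl: "?F (a + b - c) = ?F a + ?F b - ?F c"
    by (rule floor_unique) (use eq assms in simp_all)
  then show "tau r (a + b - c) = tau r a + tau r b - tau r c"
    by (simp add: tau_def vec_eq_iff coord_def)
  show "phi (a + b - c) = phi a + phi b - phi c"
    unfolding frac_def[of "r \<bullet> real_vec (a + b - c)"] fl using eq by simp
qed

lemma tau_funpow_add_diff:
  assumes "\<And>j. j < k \<Longrightarrow> 0 \<le> phi ((tau r ^^ j) a) + phi ((tau r ^^ j) b) - phi ((tau r ^^ j) c)"
    and "\<And>j. j < k \<Longrightarrow> phi ((tau r ^^ j) a) + phi ((tau r ^^ j) b) - phi ((tau r ^^ j) c) < 1"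
  shows "(tau r ^^ k) (a + b - c) = (tau r ^^ k) a + (tau r ^^ k) b - (tau r ^^ k) c"
  using assms
proof (induction k)
  case (Suc k)
  then have "(tau r ^^ k) (a + b - c) = (tau r ^^ k) a + (tau r ^^ k) b - (tau r ^^ k) c" by simp
  then show ?case using tau_add_diff(1)[OF Suc.prems[of k]] by simp
qed simp

text \<open>
  By pigeonhole, finitely many vectors \<open>u\<close> suffice so that every \<open>v\<close> has, for some \<open>u\<close>, almost the
  same fractional parts along its orbit; then \<open>w\<^sub>0 + v - u\<close> inherits small fractional parts from \<open>w\<^sub>0\<close>.
\<close>

lemma rel_dense_of_positive:
  assumes pos: "\<And>k. k < n \<Longrightarrow> 0 < phi ((tau r ^^ k) w0)"
    and less: "\<And>k. k < n \<Longrightarrow> phi ((tau r ^^ k) w0) < \<eta>"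
  shows "rel_dense (small_frac n \<eta>)"
proof -
  let ?\<phi> = "\<lambda>w k. phi ((tau r ^^ k) w)"
  \<comment> \<open>\<delta> is the margin of \<open>w0\<close> above 0 and below
    \<open>min \<eta> 1\<close>, where 1 keeps floors additive and \<eta> gives smallness. The
    element 1 covers n = 0.\<close>
  define D where "D = insert 1 (?\<phi> w0 ` {..<n} \<union> (\<lambda>k. min \<eta> 1 - ?\<phi> w0 k) ` {..<n})"
  define \<delta> where "\<delta> = Min D"
  have "finite D" by (simp add: D_def)
  have \<delta>: "\<delta> > 0"
    unfolding \<delta>_def using \<open>finite D\<close> pos less
    by (subst Min_gr_iff) (auto simp: D_def frac_lt_1)
  have \<delta>_le: "\<delta> \<le> ?\<phi> w0 k" "?\<phi> w0 k + \<delta> \<le> min \<eta> 1" if "k < n" for k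
  proof -
    show "\<delta> \<le> ?\<phi> w0 k"
      unfolding \<delta>_def by (rule Min_le[OF \<open>finite D\<close>]) (use that in \<open>auto simp: D_def\<close>)
    have "\<delta> \<le> min \<eta> 1 - ?\<phi> w0 k"
      unfolding \<delta>_def by (rule Min_le[OF \<open>finite D\<close>]) (use that in \<open>auto simp: D_def\<close>)
    then show "?\<phi> w0 k + \<delta> \<le> min \<eta> 1" by linarith
  qed
  \<comment> \<open>The pigeonholes are cubes of side \<delta>: vectors in the same one have
    fractional parts less than \<delta> apart at each of the n steps.\<close>
  define code where "code w = (\<lambda>k\<in>{..<n}. \<lfloor>?\<phi> w k / \<delta>\<rfloor>)" for w
  have "range code \<subseteq> {..<n} \<rightarrow>\<^sub>E {0..\<lfloor>1 / \<delta>\<rfloor>}"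
  proof (rule image_subsetI, rule PiE_I)
    fix w k assume "k \<in> {..<n}"
    moreover have "?\<phi> w k / \<delta> \<le> 1 / \<delta>"
      using \<delta> frac_lt_1[of "r \<bullet> real_vec ((tau r ^^ k) w)"] by (intro divide_right_mono) auto
    then have "\<lfloor>?\<phi> w k / \<delta>\<rfloor> \<le> \<lfloor>1 / \<delta>\<rfloor>" by (rule floor_mono)
    moreover have "0 \<le> \<lfloor>?\<phi> w k / \<delta>\<rfloor>" using \<delta> by simp
    ultimately show "code w k \<in> {0..\<lfloor>1 / \<delta>\<rfloor>}" by (simp add: code_def)
  qed (simp add: code_def)
  then have fin: "finite (range code)" by (rule finite_subset) (intro finite_PiE; simp)
  define rep where "rep c = (SOME w. code w = c)" for c
  have rep: "code (rep (code v)) = code v" for v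
    unfolding rep_def by (rule someI[of _ v]) (rule refl)
  define B where "B = Max ((\<lambda>c. norm (real_vec w0 - real_vec (rep c))) ` range code)"
  have "\<exists>w\<in>small_frac n \<eta>. norm (real_vec w - real_vec v) \<le> B" for v
  proof
    define u where "u = rep (code v)"
    have close: "\<bar>?\<phi> v k - ?\<phi> u k\<bar> < \<delta>" if "k < n" for k
    proof -
      have "code v k = code u k" by (simp add: u_def rep)
      then have "\<lfloor>?\<phi> v k / \<delta>\<rfloor> = \<lfloor>?\<phi> u k / \<delta>\<rfloor>" using that by (simp add: code_def)
      then have "\<bar>?\<phi> v k / \<delta> - ?\<phi> u k / \<delta>\<bar> < 1" by linarith
      then have "\<bar>?\<phi> v k - ?\<phi> u k\<bar> / \<delta> < 1" using \<delta> by (simp add: diff_divide_distrib[symmetric] abs_divide)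
      then show ?thesis using \<delta> by simp
    qed
    have bounds: "0 \<le> ?\<phi> w0 k + ?\<phi> v k - ?\<phi> u k" "?\<phi> w0 k + ?\<phi> v k - ?\<phi> u k < min \<eta> 1" if "k < n" for k
      using close[OF that] \<delta>_le[OF that] by linarith+
    show "w0 + v - u \<in> small_frac n \<eta>"
      unfolding small_frac_def
    proof (intro CollectI allI impI)
      fix k assume k: "k < n"
      have "(tau r ^^ k) (w0 + v - u) = (tau r ^^ k) w0 + (tau r ^^ k) v - (tau r ^^ k) u"
        by (rule tau_funpow_add_diff) (use bounds k in force)+
      moreover have "phi ((tau r ^^ k) w0 + (tau r ^^ k) v - (tau r ^^ k) u) = ?\<phi> w0 k + ?\<phi> v k - ?\<phi> u k"
        by (rule tau_add_diff(2)) (use bounds[OF k] in auto)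
      ultimately show "phi ((tau r ^^ k) (w0 + v - u)) < \<eta>" using bounds[OF k] by simp
    qed
    have "real_vec (w0 + v - u) - real_vec v = real_vec w0 - real_vec (rep (code v))"
      by (simp add: real_vec_add real_vec_diff u_def)
    then show "norm (real_vec (w0 + v - u) - real_vec v) \<le> B"
      unfolding B_def by (intro Max_ge) (use fin in auto)
  qed
  then show ?thesis unfolding rel_dense_def by blast
qed

section \<open>Parameters related to beta-transformations\<close>

text \<open>The functional \<open>phi\<close> semiconjugates \<open>tau r\<close> to the \<open>\<beta>\<close>-transformation.\<close>

lemma phi_tau_beta:
  assumes "integer_poly ([:- \<beta>, 1:] * srs_poly r)"
  shows "phi (tau r z) = frac (\<beta> * phi z)"
proof -
  let ?d = "CARD('n)" and ?c = "coeff (srs_poly r)"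
  \<comment> \<open>Up to sign these are the coefficients of \<open>(X - \<beta>) p\<close>, and
    exactly they remain when \<beta> times the recurrence defect is subtracted from the next inner
    product.\<close>
  have c0: "\<beta> * ?c 0 \<in> \<int>"
    using assms[unfolded integer_poly_def, rule_format, of 0] by simp
  have cS: "?c k - \<beta> * ?c (Suc k) \<in> \<int>" for k
    using assms[unfolded integer_poly_def, rule_format, of "Suc k"] by (simp add: algebra_simps)
  let ?Z = "tau_seq r z"
  have "r \<bullet> real_vec (tau r z) = (\<Sum>k<?d. ?c k * ?Z (Suc k))"
    unfolding inner_coord by (rule sum.cong) (auto simp: coeff_srs_poly coord_real_vec coord_tau_seq)
  moreover have "\<beta> * phi z = \<beta> * ?c 0 * ?Z 0 + (\<Sum>k<?d. \<beta> * ?c (Suc k) * ?Z (Suc k))"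
  proof -
    have "phi z = ?c 0 * ?Z 0 + (\<Sum>k<?d. ?c (Suc k) * ?Z (Suc k))"
      unfolding sum_coeff_tau_seq[symmetric] lessThan_Suc_atMost[symmetric] by (rule sum.lessThan_Suc_shift)
    then show ?thesis by (simp add: distrib_left sum_distrib_left mult.assoc)
  qed
  ultimately have "r \<bullet> real_vec (tau r z) - \<beta> * phi z
      = (\<Sum>k<?d. (?c k - \<beta> * ?c (Suc k)) * ?Z (Suc k)) - \<beta> * ?c 0 * ?Z 0"
    by (simp add: sum_subtractf left_diff_distrib)
  also have "\<dots> \<in> \<int>" by (intro Ints_diff Ints_sum Ints_mult c0 cS Ints_of_int)
  finally show ?thesis
    using frac_add_int_right[of "r \<bullet> real_vec (tau r z) - \<beta> * phi z" "\<beta> * phi z"] by simp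
qed

text \<open>A multiple of the unit vector at an irrational coordinate has arbitrarily small positive
  fractional part. Started below \<open>min \<eta> 1 / \<beta> ^ n\<close>, the
  \<beta>-transformation is plain multiplication for n steps, so positivity survives.\<close>

lemma rel_dense_beta:
  assumes poly: "integer_poly ([:- \<beta>, 1:] * srs_poly r)" and "\<beta> > 1" and irr: "r $ i \<notin> \<rat>" and "\<eta> > 0"
  shows "rel_dense (small_frac n \<eta>)"
proof -
  have \<beta>n: "\<beta> ^ n > 0" using \<open>\<beta> > 1\<close> by simp
  then have "min \<eta> 1 / \<beta> ^ n > 0" using \<open>\<eta> > 0\<close> by simp
  then obtain k :: int where k: "0 < frac (k * r $ i)" "frac (k * r $ i) < min \<eta> 1 / \<beta> ^ n"
    using irrational_small_frac[OF irr] by metis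
  define w0 :: "int ^ 'n::{finite,linorder}" where "w0 = (\<chi> j. if j = i then k else 0)"
  have "r \<bullet> real_vec w0 = (\<Sum>j\<in>UNIV. if j = i then k * r $ i else 0)"
    unfolding inner_vec_def by (rule sum.cong) (auto simp: w0_def real_vec_def)
  then have w0: "phi w0 = frac (k * r $ i)" by simp
  have small: "\<beta> ^ j * phi w0 < min \<eta> 1" if "j \<le> n" for j
  proof -
    have "\<beta> ^ j * phi w0 \<le> \<beta> ^ n * phi w0"
      using \<open>\<beta> > 1\<close> that by (intro mult_right_mono power_increasing) auto
    also have "\<dots> < min \<eta> 1" using k(2) \<beta>n by (simp add: w0 field_simps)
    finally show ?thesis .
  qed
  have phi: "phi ((tau r ^^ j) w0) = \<beta> ^ j * phi w0" if "j \<le> n" for j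
    using that
  proof (induction j)
    case (Suc j)
    have "frac (\<beta> ^ Suc j * phi w0) = \<beta> ^ Suc j * phi w0"
      using small[OF Suc.prems] \<open>\<beta> > 1\<close> by (intro frac_eq[THEN iffD2]) auto
    then show ?case using Suc phi_tau_beta[OF poly, of "(tau r ^^ j) w0"] by (simp add: mult.assoc)
  qed simp
  show ?thesis
  proof (rule rel_dense_of_positive)
    fix j assume "j < n"
    then show "0 < phi ((tau r ^^ j) w0)" "phi ((tau r ^^ j) w0) < \<eta>"
      using phi[of j] small[of j] k(1) \<open>\<beta> > 1\<close> by (simp_all add: w0)
  qed
qed

section \<open>Algebraically independent parameters\<close>

lemma real_vec_tau_funpow:
  "real_vec ((tau r ^^ k) z) = (M ^^ k) (real_vec z) + (\<Sum>j<k. phi ((tau r ^^ j) z) *\<^sub>R (M ^^ (k - Suc j)) e_last)"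
proof (induction k)
  case (Suc k)
  have "M (\<Sum>j<k. phi ((tau r ^^ j) z) *\<^sub>R (M ^^ (k - Suc j)) e_last)
      = (\<Sum>j<k. phi ((tau r ^^ j) z) *\<^sub>R (M ^^ (Suc k - Suc j)) e_last)"
    unfolding linear_sum[OF matrix_vector_mul_linear]
  proof (rule sum.cong)
    fix j assume "j \<in> {..<k}"
    then have "Suc k - Suc j = Suc (k - Suc j)" by auto
    then show "M (phi ((tau r ^^ j) z) *\<^sub>R (M ^^ (k - Suc j)) e_last)
        = phi ((tau r ^^ j) z) *\<^sub>R (M ^^ (Suc k - Suc j)) e_last"
      by (simp add: matrix_vector_mult_scaleR)
  qed simp
  then show ?case
    by (simp add: real_vec_tau Suc.IH matrix_vector_right_distrib)
qed simp

text \<open>All n fractional parts are steered to a common value \<open>h\<close>. Each depends on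
  the earlier ones through rounding, so deviations from \<open>h\<close> are bounded
  recursively.\<close>

lemma rel_dense_algebraically_independent:
  assumes "algebraically_independent r" "\<eta> > 0"
  shows "rel_dense (small_frac n \<eta>)"
proof -
  \<comment> \<open>The midpoint of (0, \<open>min \<eta> 1\<close>): any deviation smaller than
    \<open>h\<close> is harmless.\<close>
  define h where "h = min \<eta> 1 / 2"
  have h: "h > 0" "2 * h \<le> \<eta>" "2 * h \<le> 1" using assms(2) by (auto simp: h_def)
  define c where "c k = r \<bullet> (M ^^ k) e_last" for k
  define C where "C = (\<Sum>k<n. \<bar>c k\<bar>)"
  have C: "C \<ge> 0" "\<And>k. k < n \<Longrightarrow> \<bar>c k\<bar> \<le> C"
    unfolding C_def by (simp add: sum_nonneg) (rule member_le_sum; simp)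
  \<comment> \<open>The bound on the deviation grows by the factor 1 + C per step, and n such
    factors must not exceed \<open>h\<close>.\<close>
  define \<epsilon> where "\<epsilon> = h / (1 + C) ^ n"
  have \<epsilon>: "\<epsilon> > 0" using h C(1) by (simp add: \<epsilon>_def)
  \<comment> \<open>If all earlier fractional parts were exactly \<open>h\<close>, the k-th inner
    product would be \<open>t * c k\<close> plus the sum subtracted here; it should be congruent to
    \<open>h\<close> modulo 1.\<close>
  define \<alpha> where "\<alpha> k = h - (\<Sum>j<k. h * c (k - Suc j))" for k
  obtain t :: int and m :: "nat \<Rightarrow> int" where tm: "\<And>k. k < n \<Longrightarrow> \<bar>t * c k - m k - \<alpha> k\<bar> < \<epsilon>"
  proof (rule kronecker_integer_relations[where \<theta> = c and n = n and \<alpha> = \<alpha>, OF _ \<epsilon>])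
    show "\<forall>k<n. u k = 0" if "(\<Sum>k<n. u k * c k) \<in> \<int>" for u :: "nat \<Rightarrow> int"
      using that unfolding c_def by (rule algebraically_independent_integer_relations[OF assms(1)])
  next
    fix t :: int and m :: "nat \<Rightarrow> int"
    assume "\<And>k. k < n \<Longrightarrow> \<bar>t * c k - m k - \<alpha> k\<bar> < \<epsilon>"
    then show thesis by (rule that[of t m])
  qed
  define w0 :: "int ^ 'n::{finite,linorder}" where "w0 = (\<chi> i. if pos i = CARD('n) - 1 then t else 0)"
  have w0: "real_vec w0 = t *\<^sub>R e_last" by (simp add: w0_def real_vec_def e_last_def vec_eq_iff)
  let ?\<phi> = "\<lambda>k. phi ((tau r ^^ k) w0)"
  have close: "\<bar>?\<phi> k - h\<bar> < \<epsilon> * (1 + C) ^ k" if "k < n" for k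
    using that
  proof (induction k rule: less_induct)
    case (less k)
    define x where "x = r \<bullet> real_vec ((tau r ^^ k) w0)"
    have "x = t * c k + (\<Sum>j<k. ?\<phi> j * c (k - Suc j))"
      unfolding x_def real_vec_tau_funpow[of k w0]
      by (simp add: w0 M_funpow_scaleR inner_add_right inner_sum_right c_def)
    then have "x - m k - h = (t * c k - m k - \<alpha> k) + (\<Sum>j<k. (?\<phi> j - h) * c (k - Suc j))"
      by (simp add: \<alpha>_def left_diff_distrib sum_subtractf)
    moreover have "\<bar>\<Sum>j<k. (?\<phi> j - h) * c (k - Suc j)\<bar> \<le> (\<Sum>j<k. \<epsilon> * (1 + C) ^ j * C)"
    proof (rule order_trans[OF sum_abs sum_mono])
      fix j assume j: "j \<in> {..<k}"
      have "\<bar>?\<phi> j - h\<bar> \<le> \<epsilon> * (1 + C) ^ j" using less.IH[of j] j less.prems by simp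
      moreover have "\<bar>c (k - Suc j)\<bar> \<le> C" using C(2) less.prems by simp
      ultimately show "\<bar>(?\<phi> j - h) * c (k - Suc j)\<bar> \<le> \<epsilon> * (1 + C) ^ j * C"
        unfolding abs_mult by (intro mult_mono) (use \<epsilon> C(1) in auto)
    qed
    \<comment> \<open>Together with the Kronecker error \<epsilon> this is exactly
      \<open>\<epsilon> * (1 + C) ^ k\<close>.\<close>
    moreover have "(\<Sum>j<k. \<epsilon> * (1 + C) ^ j * C) = \<epsilon> * (1 + C) ^ k - \<epsilon>"
      by (induction k) (auto simp: algebra_simps)
    ultimately have x: "\<bar>x - m k - h\<bar> < \<epsilon> * (1 + C) ^ k"
      using tm[OF less.prems] by linarith
    have "\<epsilon> * (1 + C) ^ k \<le> \<epsilon> * (1 + C) ^ n"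
      using \<epsilon> C(1) less.prems by (intro mult_left_mono power_increasing) auto
    also have "\<dots> = h" using C(1) by (simp add: \<epsilon>_def)
    finally have "0 < x - m k" "x - m k < 1" using x h by linarith+
    then have "frac x = x - m k" by (simp add: frac_unique_iff)
    then show ?case using x by (simp add: x_def)
  qed
  show ?thesis
  proof (rule rel_dense_of_positive)
    fix k assume k: "k < n"
    have "\<epsilon> * (1 + C) ^ k \<le> \<epsilon> * (1 + C) ^ n"
      using \<epsilon> C(1) k by (intro mult_left_mono power_increasing) auto
    also have "\<dots> = h" using C(1) by (simp add: \<epsilon>_def)
    finally show "0 < ?\<phi> k" "?\<phi> k < \<eta>" using close[OF k] h by linarith+
  qed
qed

end

theorem theorem4p6:
  fixes r :: "real ^ 'n::{finite,linorder}" and m :: nat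
  assumes "r \<in> interior srs_D"
    and "coord r 0 \<noteq> 0"
    and "m = covering_degree (srs_tile r)"
    and "(\<forall>i. r $ i \<in> \<rat>)
       \<or> (\<exists>\<beta>::real. \<beta> > 1 \<and> integer_poly ([:- \<beta>, 1:] * srs_poly r))
       \<or> algebraically_independent r"
  shows "closure (exclusive_points (srs_tile r)) = UNIV \<and> weak_tiling m (srs_tile r)"
proof -
  interpret contracting_srs r
    using assms(1,2) interior_srs_D_root_norm_less_1 by unfold_locales auto
  have "rel_dense (small_frac n \<eta>)" if "\<eta> > 0" for n \<eta>
  proof -
    \<comment> \<open>A rational r with a suitable \<beta> is put into the first case, so the second
      comes with an irrational coordinate.\<close>
    consider "\<forall>i. r $ i \<in> \<rat>" | \<beta> i where "\<beta> > 1" "integer_poly ([:- \<beta>, 1:] * srs_poly r)" "r $ i \<notin> \<rat>"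
      | "algebraically_independent r"
      using assms(4) by blast
    then show ?thesis
    proof cases
      case 1
      then show ?thesis using that by (intro rel_dense_rational) auto
    next
      case 2
      then show ?thesis using that by (intro rel_dense_beta)
    next
      case 3
      then show ?thesis using that by (rule rel_dense_algebraically_independent)
    qed
  qed
  then have "closure (exclusive_points (srs_tile r)) = UNIV" by (rule exclusive_points_dense)
  then show ?thesis using weak_tiling_of_dense_exclusive assms(3) by simp
qed

end
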